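(* Let $v$ be a typical weight, let $T$ be an intrinsic operator on $\mathcal{H}(\mathbb{D})$ and let $X$ be an initial space. (i) Suppose $T:X\to H_v$ is bounded. Then $T:X\to H_v$ is compact (respectively weakly compact) if and only if the set $\{v(z)T^*K_z^H: z\in\mathbb{D}\}$ is relatively compact (respectively relatively weakly compact) in $X^*$. (ii) Suppose $T:X\to\mathcal{B}_v$ is bounded. Then $T:X\to\mathcal{B}_v$ is compact (respectively weakly compact) if and only if the set $\{v(z)T^*K_{z,1}^{\mathcal{B}}: z\in\mathbb{D}\}$ is relatively compact (respectively relatively weakly compact) in $X^*$.
   Context: $\mathcal{H}(\mathbb{D})$ is the space of holomorphic functions on the unit disk $\mathbb{D}$ with the topology $\tau_{uc}$ of uniform convergence on compact subsets. A linear operator $T$ on $\mathcal{H}(\mathbb{D})$ is intrinsic if it maps $\tau_{uc}$-convergent sequences to $\tau_{uc}$-convergent sequences. An initial space is a Banach space $X\subset\mathcal{H}(\mathbb{D})$ containing the polynomials such that every sequence in the closed unit ball of $X$ has a subsequence converging in $\tau_{uc}$ to some function in $X$. A typical weight is a continuous radial $v:\mathbb{D}\to(0,1]$, non-increasing in $|z|$, with $v(z)\to0$ as $|z|\to1$. $H_v=\{f\in\mathcal{H}(\mathbb{D}):\sup_z v(z)|f(z)|<\infty\}$ with that supremum as norm; $\mathcal{B}_v=\{f:\sup_z v(z)|f'(z)|<\infty\}$ with norm $|f(0)|+\sup_z v(z)|f'(z)|$. $K_z^H\in H_v^*$ is the point evaluation $g\mapsto g(z)$ and $K_{z,1}^{\mathcal{B}}\in\mathcal{B}_v^*$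 the derivative point evaluation $g\mapsto g'(z)$. $T^*$ denotes the Banach-space adjoint of $T:X\to H_v$ (resp. $T:X\to\mathcal{B}_v$). *)

theory Defs
  imports "HOL-Analysis.Analysis" "HOL-Computational_Algebra.Polynomial" "HOL-Library.Function_Algebras"
begin

text \<open>All spaces considered are sets V of complex-valued functions (on some type 'b)
  with a norm N :: ('b => complex) => real; vector operations are pointwise.\<close>

definition csmul :: "complex \<Rightarrow> ('b \<Rightarrow> complex) \<Rightarrow> ('b \<Rightarrow> complex)" where
  "csmul c f = (\<lambda>x. c * f x)"

definition is_banach_fs :: "('b \<Rightarrow> complex) set \<Rightarrow> (('b \<Rightarrow> complex) \<Rightarrow> real) \<Rightarrow> bool" where
  "is_banach_fs V N \<longleftrightarrow>
     0 \<in> V \<and> (\<forall>f\<in>V. \<forall>g\<in>V. f + g \<in> V) \<and> (\<forall>c. \<forall>f\<in>V. csmul c f \<in> V) \<and>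
     (\<forall>f\<in>V. 0 \<le> N f) \<and> (\<forall>f\<in>V. N f = 0 \<longleftrightarrow> f = 0) \<and>
     (\<forall>f\<in>V. \<forall>g\<in>V. N (f + g) \<le> N f + N g) \<and>
     (\<forall>c. \<forall>f\<in>V. N (csmul c f) = cmod c * N f) \<and>
     (\<forall>fs. (\<forall>n. fs n \<in> V) \<and> (\<forall>e>0. \<exists>M::nat. \<forall>m\<ge>M. \<forall>n\<ge>M. N (fs m - fs n) < e)
           \<longrightarrow> (\<exists>f\<in>V. \<forall>e>0. \<exists>M::nat. \<forall>n\<ge>M. N (fs n - f) < e))"

definition unit_ball_fs :: "('b \<Rightarrow> complex) set \<Rightarrow> (('b \<Rightarrow> complex) \<Rightarrow> real) \<Rightarrow> ('b \<Rightarrow> complex) set" where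
  "unit_ball_fs V N = {f \<in> V. N f \<le> 1}"

text \<open>Bounded linear functionals on V (the dual space V*), made extensional
  (value 0 outside V) so that they are determined by their action on V.\<close>
definition dual_fs :: "('b \<Rightarrow> complex) set \<Rightarrow> (('b \<Rightarrow> complex) \<Rightarrow> real) \<Rightarrow> (('b \<Rightarrow> complex) \<Rightarrow> complex) set" where
  "dual_fs V N = {\<phi>.
     (\<forall>f\<in>V. \<forall>g\<in>V. \<phi> (f + g) = \<phi> f + \<phi> g) \<and>
     (\<forall>c. \<forall>f\<in>V. \<phi> (csmul c f) = c * \<phi> f) \<and>
     (\<exists>C. \<forall>f\<in>V. cmod (\<phi> f) \<le> C * N f) \<and>
     (\<forall>f. f \<notin> V \<longrightarrow> \<phi> f = 0)}"

definition dnorm_fs :: "('b \<Rightarrow> complex) set \<Rightarrow> (('b \<Rightarrow> complex) \<Rightarrow> real) \<Rightarrow> (('b \<Rightarrow> complex) \<Rightarrow> complex) \<Rightarrow> real" where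
  "dnorm_fs V N \<phi> = (SUP f \<in> unit_ball_fs V N. cmod (\<phi> f))"

definition norm_top_fs :: "('b \<Rightarrow> complex) set \<Rightarrow> (('b \<Rightarrow> complex) \<Rightarrow> real) \<Rightarrow> ('b \<Rightarrow> complex) topology" where
  "norm_top_fs V N = topology_generated_by {{g \<in> V. N (g - f) < r} | f r. f \<in> V}"

definition weak_top_fs :: "('b \<Rightarrow> complex) set \<Rightarrow> (('b \<Rightarrow> complex) \<Rightarrow> real) \<Rightarrow> ('b \<Rightarrow> complex) topology" where
  "weak_top_fs V N = topology_generated_by {{g \<in> V. \<psi> g \<in> U} | \<psi> U. \<psi> \<in> dual_fs V N \<and> open U}"

definition rel_compact_in :: "'a topology \<Rightarrow> 'a set \<Rightarrow> bool" where
  "rel_compact_in \<tau> S \<longleftrightarrow> compactin \<tau> (\<tau> closure_of S)"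

abbreviation disk :: "complex set" where "disk \<equiv> ball 0 1"

text \<open>H(D); functions are normalised to be 0 off the disk so that H(D) elements
  are identified with holomorphic functions on the disk.\<close>
definition Hol :: "(complex \<Rightarrow> complex) set" where
  "Hol = {f. f holomorphic_on disk \<and> (\<forall>z. z \<notin> disk \<longrightarrow> f z = 0)}"

definition uc_conv :: "(nat \<Rightarrow> complex \<Rightarrow> complex) \<Rightarrow> (complex \<Rightarrow> complex) \<Rightarrow> bool" where
  "uc_conv fs f \<longleftrightarrow> (\<forall>K. compact K \<and> K \<subseteq> disk \<longrightarrow> uniform_limit K fs f sequentially)"

definition linear_on_Hol :: "((complex \<Rightarrow> complex) \<Rightarrow> (complex \<Rightarrow> complex)) \<Rightarrow> bool" where
  "linear_on_Hol T \<longleftrightarrow> T ` Hol \<subseteq> Hol \<and>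
     (\<forall>f\<in>Hol. \<forall>g\<in>Hol. T (f + g) = T f + T g) \<and>
     (\<forall>c. \<forall>f\<in>Hol. T (csmul c f) = csmul c (T f))"

definition intrinsic :: "((complex \<Rightarrow> complex) \<Rightarrow> (complex \<Rightarrow> complex)) \<Rightarrow> bool" where
  "intrinsic T \<longleftrightarrow> linear_on_Hol T \<and>
     (\<forall>fs f. (\<forall>n. fs n \<in> Hol) \<and> f \<in> Hol \<and> uc_conv fs f
        \<longrightarrow> (\<exists>g\<in>Hol. uc_conv (\<lambda>n. T (fs n)) g))"

definition poly_on_disk :: "complex poly \<Rightarrow> (complex \<Rightarrow> complex)" where
  "poly_on_disk p = (\<lambda>z. if z \<in> disk then poly p z else 0)"

definition initial_space :: "(complex \<Rightarrow> complex) set \<Rightarrow> ((complex \<Rightarrow> complex) \<Rightarrow> real) \<Rightarrow> bool" where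
  "initial_space X N \<longleftrightarrow> X \<subseteq> Hol \<and> is_banach_fs X N \<and>
     (\<forall>p. poly_on_disk p \<in> X) \<and>
     (\<forall>fs. (\<forall>n. fs n \<in> unit_ball_fs X N) \<longrightarrow>
        (\<exists>(r::nat\<Rightarrow>nat) f. strict_mono r \<and> f \<in> X \<and> uc_conv (fs \<circ> r) f))"

definition typical_weight :: "(complex \<Rightarrow> real) \<Rightarrow> bool" where
  "typical_weight v \<longleftrightarrow> continuous_on disk v \<and>
     (\<forall>z\<in>disk. 0 < v z \<and> v z \<le> 1) \<and>
     (\<forall>z\<in>disk. \<forall>w\<in>disk. cmod z \<le> cmod w \<longrightarrow> v w \<le> v z) \<and>
     (\<forall>e>0. \<exists>r<1. \<forall>z\<in>disk. r < cmod z \<longrightarrow> v z < e)"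

text \<open>(radial follows from the non-increasing condition with |z| = |w|.)\<close>

definition Hv :: "(complex \<Rightarrow> real) \<Rightarrow> (complex \<Rightarrow> complex) set" where
  "Hv v = {f \<in> Hol. bdd_above ((\<lambda>z. v z * cmod (f z)) ` disk)}"

definition Hv_norm :: "(complex \<Rightarrow> real) \<Rightarrow> (complex \<Rightarrow> complex) \<Rightarrow> real" where
  "Hv_norm v f = (SUP z \<in> disk. v z * cmod (f z))"

definition Bv :: "(complex \<Rightarrow> real) \<Rightarrow> (complex \<Rightarrow> complex) set" where
  "Bv v = {f \<in> Hol. bdd_above ((\<lambda>z. v z * cmod (deriv f z)) ` disk)}"

definition Bv_norm :: "(complex \<Rightarrow> real) \<Rightarrow> (complex \<Rightarrow> complex) \<Rightarrow> real" where
  "Bv_norm v f = cmod (f 0) + (SUP z \<in> disk. v z * cmod (deriv f z))"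

definition KH :: "(complex \<Rightarrow> real) \<Rightarrow> complex \<Rightarrow> ((complex \<Rightarrow> complex) \<Rightarrow> complex)" where
  "KH v z = (\<lambda>g. if g \<in> Hv v then g z else 0)"

definition KB1 :: "(complex \<Rightarrow> real) \<Rightarrow> complex \<Rightarrow> ((complex \<Rightarrow> complex) \<Rightarrow> complex)" where
  "KB1 v z = (\<lambda>g. if g \<in> Bv v then deriv g z else 0)"

definition bounded_op :: "('a \<Rightarrow> complex) set \<Rightarrow> (('a \<Rightarrow> complex) \<Rightarrow> real) \<Rightarrow>
    ('b \<Rightarrow> complex) set \<Rightarrow> (('b \<Rightarrow> complex) \<Rightarrow> real) \<Rightarrow> (('a \<Rightarrow> complex) \<Rightarrow> ('b \<Rightarrow> complex)) \<Rightarrow> bool" where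
  "bounded_op X NX Y NY T \<longleftrightarrow> T ` X \<subseteq> Y \<and> (\<exists>C. \<forall>f\<in>X. NY (T f) \<le> C * NX f)"

definition compact_op :: "('a \<Rightarrow> complex) set \<Rightarrow> (('a \<Rightarrow> complex) \<Rightarrow> real) \<Rightarrow>
    ('b \<Rightarrow> complex) set \<Rightarrow> (('b \<Rightarrow> complex) \<Rightarrow> real) \<Rightarrow> (('a \<Rightarrow> complex) \<Rightarrow> ('b \<Rightarrow> complex)) \<Rightarrow> bool" where
  "compact_op X NX Y NY T \<longleftrightarrow> rel_compact_in (norm_top_fs Y NY) (T ` unit_ball_fs X NX)"

definition weakly_compact_op :: "('a \<Rightarrow> complex) set \<Rightarrow> (('a \<Rightarrow> complex) \<Rightarrow> real) \<Rightarrow>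
    ('b \<Rightarrow> complex) set \<Rightarrow> (('b \<Rightarrow> complex) \<Rightarrow> real) \<Rightarrow> (('a \<Rightarrow> complex) \<Rightarrow> ('b \<Rightarrow> complex)) \<Rightarrow> bool" where
  "weakly_compact_op X NX Y NY T \<longleftrightarrow> rel_compact_in (weak_top_fs Y NY) (T ` unit_ball_fs X NX)"

definition adjoint_op :: "('a \<Rightarrow> complex) set \<Rightarrow> (('a \<Rightarrow> complex) \<Rightarrow> ('b \<Rightarrow> complex)) \<Rightarrow>
    (('b \<Rightarrow> complex) \<Rightarrow> complex) \<Rightarrow> (('a \<Rightarrow> complex) \<Rightarrow> complex)" where
  "adjoint_op X T \<phi> = (\<lambda>f. if f \<in> X then \<phi> (T f) else 0)"

end

theory Submission
  imports Defs "HOL-Complex_Analysis.Complex_Analysis"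
begin

text \<open>
  The spaces \<open>H\<^sub>v\<close>, \<open>B\<^sub>v\<close> and \<open>X\<^sup>*\<close> all carry a norm given (up to equivalence) by the supremum over a family
  of functionals: weighted point evaluations, respectively evaluations at the unit ball of \<open>X\<close>.  The kernel
  \<open>k(f, z) = v(z) (T f)(z)\<close> on the product of the unit ball and the disk therefore describes both
  \<open>T\<close> on the unit ball and the set of functionals \<open>v(z) T\<^sup>* K\<^sub>z\<close>, and the two sides of the equivalence differ only by
  exchanging the roles of the two variables.

  For compactness this is the symmetry of total boundedness of a bounded kernel in its two variables.  For weak
  compactness, let \<open>W\<close> be the weakly compact closure on one side and \<open>Q\<close> the pointwise closure of the norming functionals
  there, which is compact by Tychonoff.  Weak separability of \<open>W\<close> gives a metrizable quotient of \<open>Q\<close>,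
  and this quotient maps onto a set containing the other side.  The map is weakly continuous
  because it is sequentially so: a bounded sequence that tends to \<open>0\<close> under every functional in the pointwise closure
  of the norming family is weakly null.  The last fact is proved by Simons' convexity argument, which replaces the
  Riesz representation theorem and the Hahn-Banach theorem.
\<close>

subsection \<open>Products and relative compactness\<close>

text \<open>The classical duality theorems speak of the image of the whole dual ball under the
  adjoint, whereas the theorem offers only the weighted evaluations. Passing from their image to
  that of the closed absolutely convex hull would, in the weak case, call for a theorem of
  Krein-Smulian type. Exchanging the two variables only requires that the evaluations determine the
  norm up to a constant, so the hull never enters. The obstacle is that Simons' argument builds a
  series out of a sequence and says nothing about nets. Weak continuity can therefore be tested only
  on a metrizable space, and the metrizable quotient exists only if countably many points are weakly
  dense in the compact set. A countable dense subset of the disk supplies them, in a different way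
  for each direction. For the Bloch-type space the derivative evaluations annihilate constants.
  Evaluation at the origin is added to obtain a norming family; it contributes a single further
  point to the set in the dual, which does not affect relative compactness.\<close>

lemma compact_imp_closed_fun:
  fixes K :: "('a \<Rightarrow> 'b::metric_space) set"
  assumes "compact K"
  shows "closed K"
proof -
  have "Hausdorff_space (product_topology (\<lambda>_ :: 'a. euclidean :: 'b topology) UNIV)"
    unfolding Hausdorff_space_product_topology by simp
  then have "Hausdorff_space (euclidean :: ('a \<Rightarrow> 'b) topology)"
    by (simp only: euclidean_product_topology)
  then show ?thesis
    using assms compactin_imp_closedin[of euclidean K] by simp
qed

text \<open>Tychonoff's theorem. It is the source of compactness in both arguments of Banach-Alaoglu
  type below.\<close>

lemma compact_box_fun:
  fixes B :: "'a \<Rightarrow> 'b::topological_space set"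
  assumes "\<And>x. compact (B x)"
  shows "compact {f. \<forall>x. f x \<in> B x}"
proof -
  have "compactin (product_topology (\<lambda>_. euclidean) UNIV) (PiE UNIV B)"
    by (simp add: compactin_PiE assms)
  moreover have "PiE UNIV B = {f. \<forall>x. f x \<in> B x}"
    by auto
  ultimately show ?thesis
    by (simp add: euclidean_product_topology)
qed

lemma continuous_on_eval: "continuous_on S (\<lambda>f :: 'a \<Rightarrow> 'b::topological_space. f x)"
  by (rule continuous_on_subset[OF continuous_on_product_coordinates]) simp

lemma closure_fun_finite_approx:
  fixes u :: "'a \<Rightarrow> complex"
  assumes "u \<in> closure S" and "finite F" and "e > 0"
  obtains f where "f \<in> S" and "\<And>x. x \<in> F \<Longrightarrow> cmod (f x - u x) < e"
proof -
  let ?U = "\<Inter>x\<in>F. {f. cmod (f x - u x) < e}"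
  have "open ?U"
    by (intro open_INT ballI open_Collect_less continuous_on_norm continuous_on_diff continuous_on_const continuous_on_eval assms)
  moreover have "u \<in> ?U"
    using assms by simp
  ultimately obtain f where "f \<in> S" "f \<in> ?U"
    using assms(1) by (meson closure_iff_nhds_not_empty disjoint_iff subset_refl)
  then show ?thesis
    using that by auto
qed

lemma tendsto_fun_iff:
  fixes f :: "'c \<Rightarrow> 'a \<Rightarrow> 'b::topological_space"
  shows "(f \<longlongrightarrow> l) F \<longleftrightarrow> (\<forall>x. ((\<lambda>i. f i x) \<longlongrightarrow> l x) F)"
proof -
  have "limitin (product_topology (\<lambda>_. euclidean) UNIV) f l F \<longleftrightarrow> (\<forall>x. ((\<lambda>i. f i x) \<longlongrightarrow> l x) F)"
    by (simp add: limitin_componentwise)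
  then show ?thesis
    by (simp add: euclidean_product_topology)
qed

lemma rel_compact_in_subset_compactin:
  assumes "Hausdorff_space \<tau>" and "compactin \<tau> C" and "S \<subseteq> C"
  shows "rel_compact_in \<tau> S"
  unfolding rel_compact_in_def
  by (meson assms closed_compactin closedin_closure_of closure_of_minimal compactin_imp_closedin)

text \<open>This discards the functional coming from evaluation at the origin: that evaluation is
  needed to norm \<open>Bv\<close>, but it is absent from the set in the theorem.\<close>

lemma rel_compact_in_insert_iff:
  assumes "Hausdorff_space \<tau>" and "x \<in> topspace \<tau>" and "S \<subseteq> topspace \<tau>"
  shows "rel_compact_in \<tau> (insert x S) \<longleftrightarrow> rel_compact_in \<tau> S"
proof
  assume "rel_compact_in \<tau> (insert x S)"
  then have "compactin \<tau> (\<tau> closure_of insert x S)"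
    by (simp add: rel_compact_in_def)
  moreover have "S \<subseteq> \<tau> closure_of insert x S"
    using closure_of_subset[of "insert x S" \<tau>] assms by simp
  ultimately show "rel_compact_in \<tau> S"
    by (rule rel_compact_in_subset_compactin[OF assms(1)])
next
  assume "rel_compact_in \<tau> S"
  then have "compactin \<tau> ({x} \<union> \<tau> closure_of S)"
    using assms by (intro compactin_Un) (simp_all add: rel_compact_in_def)
  moreover have "insert x S \<subseteq> {x} \<union> \<tau> closure_of S"
    using closure_of_subset[OF assms(3)] by auto
  ultimately show "rel_compact_in \<tau> (insert x S)"
    by (rule rel_compact_in_subset_compactin[OF assms(1)])
qed

subsection \<open>The weak topology\<close>

lemma csmul_apply [simp]: "csmul c f x = c * f x"
  by (simp add: csmul_def)

lemma topspace_weak_top_fs [simp]: "topspace (weak_top_fs V N) = V"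
proof -
  have "(\<lambda>_. 0) \<in> dual_fs V N"
    unfolding dual_fs_def by (auto intro: exI[of _ 0])
  then have "{g \<in> V. (\<lambda>_. 0) g \<in> (UNIV :: complex set)} \<in> {{g \<in> V. \<psi> g \<in> U} |\<psi> U. \<psi> \<in> dual_fs V N \<and> open U}"
    by blast
  then show ?thesis
    unfolding weak_top_fs_def topology_generated_by_topspace by blast
qed

lemma openin_weak_top_fs:
  assumes "\<psi> \<in> dual_fs V N" and "open U"
  shows "openin (weak_top_fs V N) {g \<in> V. \<psi> g \<in> U}"
  unfolding weak_top_fs_def
  by (rule topology_generated_by_Basis) (use assms in blast)

lemma continuous_map_weak_top_dual:
  assumes "\<psi> \<in> dual_fs V N"
  shows "continuous_map (weak_top_fs V N) euclidean \<psi>"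
  using openin_weak_top_fs[OF assms] by (auto simp: continuous_map_def)

lemma continuous_map_into_weak_top:
  assumes "f ` topspace \<tau> \<subseteq> V"
    and "\<And>\<psi>. \<psi> \<in> dual_fs V N \<Longrightarrow> continuous_map \<tau> euclidean (\<lambda>x. \<psi> (f x))"
  shows "continuous_map \<tau> (weak_top_fs V N) f"
  unfolding weak_top_fs_def
proof (rule continuous_on_generated_topo)
  fix W assume "W \<in> {{g \<in> V. \<psi> g \<in> U} |\<psi> U. \<psi> \<in> dual_fs V N \<and> open U}"
  then obtain \<psi> U where W: "W = {g \<in> V. \<psi> g \<in> U}" and \<psi>: "\<psi> \<in> dual_fs V N" and U: "open U"
    by blast
  have "f -` W \<inter> topspace \<tau> = {x \<in> topspace \<tau>. \<psi> (f x) \<in> U}"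
    using assms(1) W by auto
  then show "openin \<tau> (f -` W \<inter> topspace \<tau>)"
    using assms(2)[OF \<psi>] U by (simp add: continuous_map_def)
next
  show "f ` topspace \<tau> \<subseteq> \<Union> {{g \<in> V. \<psi> g \<in> U} |\<psi> U. \<psi> \<in> dual_fs V N \<and> open U}"
    using assms(1) topspace_weak_top_fs[of V N] unfolding weak_top_fs_def topology_generated_by_topspace by simp
qed

lemma Hausdorff_weak_top_fs:
  assumes "\<And>f g. \<lbrakk>f \<in> V; g \<in> V; f \<noteq> g\<rbrakk> \<Longrightarrow> \<exists>\<psi>\<in>dual_fs V N. \<psi> f \<noteq> \<psi> g"
  shows "Hausdorff_space (weak_top_fs V N)"
  unfolding Hausdorff_space_def
proof (intro allI impI)
  fix f g assume fg: "f \<in> topspace (weak_top_fs V N) \<and> g \<in> topspace (weak_top_fs V N) \<and> f \<noteq> g"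
  then obtain \<psi> where \<psi>: "\<psi> \<in> dual_fs V N" "\<psi> f \<noteq> \<psi> g"
    using assms[of f g] by auto
  obtain U U' where "open U" "open U'" "\<psi> f \<in> U" "\<psi> g \<in> U'" "U \<inter> U' = {}"
    using hausdorff[OF \<psi>(2)] by blast
  then show "\<exists>U U'. openin (weak_top_fs V N) U \<and> openin (weak_top_fs V N) U' \<and> f \<in> U \<and> g \<in> U' \<and> disjnt U U'"
    using fg \<psi>(1) openin_weak_top_fs[of \<psi> V N]
    by (intro exI[of _ "{g \<in> V. \<psi> g \<in> U}"] exI[of _ "{g \<in> V. \<psi> g \<in> U'}"]) (auto simp: disjnt_def)
qed

text \<open>On a weakly compact set, any coarser Hausdorff topology has the same closure operator.\<close>
lemma weak_closure_of_compactin: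
  fixes R :: "('a \<Rightarrow> complex) \<Rightarrow> 'b \<Rightarrow> complex"
  assumes W: "compactin (weak_top_fs V N) W" and "D \<subseteq> W" and "w \<in> W"
    and R: "continuous_map (weak_top_fs V N) euclidean R" and inj: "inj_on R W"
    and cl: "R w \<in> closure (R ` D)"
  shows "w \<in> weak_top_fs V N closure_of D"
  unfolding in_closure_of
proof (intro conjI allI impI)
  show "w \<in> topspace (weak_top_fs V N)"
    using compactin_subset_topspace[OF W] \<open>w \<in> W\<close> by auto
next
  fix U assume U: "w \<in> U \<and> openin (weak_top_fs V N) U"
  \<comment> \<open>The part of \<open>W\<close> outside \<open>U\<close> is again compact, so its
    image is closed, and by injectivity it misses \<open>R w\<close>. The complement of this image
    is a neighbourhood of \<open>R w\<close>, hence meets the image of \<open>D\<close>.\<close>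
  have "compactin (weak_top_fs V N) (W \<inter> (topspace (weak_top_fs V N) - U))"
    using U W by (intro compact_Int_closedin closedin_diff closedin_topspace) auto
  then have "closed (R ` (W \<inter> (topspace (weak_top_fs V N) - U)))" (is "closed ?C")
    using image_compactin[OF _ R] by (intro compact_imp_closed_fun) auto
  moreover have "R w \<notin> ?C"
    using inj \<open>w \<in> W\<close> U by (auto dest: inj_onD)
  ultimately have "R ` D \<inter> - ?C \<noteq> {}"
    using cl closure_iff_nhds_not_empty by (metis ComplI open_Compl subset_refl)
  then show "\<exists>y. y \<in> D \<and> y \<in> U"
    using \<open>D \<subseteq> W\<close> compactin_subset_topspace[OF W] by auto
qed

subsection \<open>Norming families\<close>

text \<open>The norm is equivalent to \<open>f \<mapsto> sup\<^sub>i \<bar>s i f\<bar>\<close>, and by the last assumption balls are closed for the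
  topology of pointwise convergence on \<open>I\<close>; this encodes both completeness and the existence of weak limits.\<close>
locale norming_family =
  fixes V :: "('a \<Rightarrow> complex) set" and N :: "('a \<Rightarrow> complex) \<Rightarrow> real"
    and I :: "'i set" and s :: "'i \<Rightarrow> ('a \<Rightarrow> complex) \<Rightarrow> complex" and C :: real
  assumes zero_mem: "0 \<in> V"
    and add_mem: "\<lbrakk>f \<in> V; g \<in> V\<rbrakk> \<Longrightarrow> f + g \<in> V"
    and csmul_mem: "f \<in> V \<Longrightarrow> csmul c f \<in> V"
    and norm_triangle: "\<lbrakk>f \<in> V; g \<in> V\<rbrakk> \<Longrightarrow> N (f + g) \<le> N f + N g"
    and norm_csmul: "f \<in> V \<Longrightarrow> N (csmul c f) = cmod c * N f"
    and norm_eq_0: "\<lbrakk>f \<in> V; N f = 0\<rbrakk> \<Longrightarrow> f = 0"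
    and index_nonempty: "I \<noteq> {}"
    and s_add: "\<lbrakk>i \<in> I; f \<in> V; g \<in> V\<rbrakk> \<Longrightarrow> s i (f + g) = s i f + s i g"
    and s_csmul: "\<lbrakk>i \<in> I; f \<in> V\<rbrakk> \<Longrightarrow> s i (csmul c f) = c * s i f"
    and s_outside: "\<lbrakk>i \<in> I; f \<notin> V\<rbrakk> \<Longrightarrow> s i f = 0"
    and s_le_norm: "\<lbrakk>i \<in> I; f \<in> V\<rbrakk> \<Longrightarrow> cmod (s i f) \<le> N f"
    and norm_le: "\<lbrakk>f \<in> V; \<And>i. i \<in> I \<Longrightarrow> cmod (s i f) \<le> a\<rbrakk> \<Longrightarrow> N f \<le> C * a"
    and const_pos: "C > 0"
    and pointwise_closed:
      "u \<in> closure ((\<lambda>f i. if i \<in> I then s i f else 0) ` {f \<in> V. N f \<le> B}) \<Longrightarrow> \<exists>f\<in>V. \<forall>i\<in>I. s i f = u i"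
begin

lemma norm_nonneg: "f \<in> V \<Longrightarrow> 0 \<le> N f"
  using s_le_norm index_nonempty norm_ge_zero order_trans by (metis all_not_in_conv)

lemma minus_eq_csmul: "f - g = f + csmul (-1) g"
  by (auto simp: fun_eq_iff)

lemma diff_mem: "\<lbrakk>f \<in> V; g \<in> V\<rbrakk> \<Longrightarrow> f - g \<in> V"
  by (simp add: minus_eq_csmul add_mem csmul_mem)

lemma norm_zero: "N 0 = 0"
proof -
  have "csmul 0 0 = (0 :: 'a \<Rightarrow> complex)"
    by (auto simp: fun_eq_iff)
  then show ?thesis
    using norm_csmul[OF zero_mem, of 0] by simp
qed

lemma norm_minus_commute:
  assumes "f \<in> V" "g \<in> V"
  shows "N (f - g) = N (g - f)"
proof -
  have "f - g = csmul (-1) (g - f)"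
    by (auto simp: fun_eq_iff)
  then show ?thesis
    using norm_csmul[OF diff_mem[OF assms(2,1)], of "-1"] by simp
qed

lemma norm_diff_triangle:
  assumes "f \<in> V" "g \<in> V" "h \<in> V"
  shows "N (f - h) \<le> N (f - g) + N (g - h)"
  using norm_triangle[OF diff_mem[OF assms(1,2)] diff_mem[OF assms(2,3)]] by simp

lemma s_diff: "\<lbrakk>i \<in> I; f \<in> V; g \<in> V\<rbrakk> \<Longrightarrow> s i (f - g) = s i f - s i g"
  by (simp add: minus_eq_csmul s_add s_csmul csmul_mem)

lemma s_separates:
  assumes "f \<in> V" "g \<in> V" "\<And>i. i \<in> I \<Longrightarrow> s i f = s i g"
  shows "f = g"
proof -
  have "N (f - g) \<le> C * 0"
    using assms by (intro norm_le diff_mem) (auto simp: s_diff)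
  then show ?thesis
    using norm_eq_0[of "f - g"] norm_nonneg[of "f - g"] diff_mem[of f g] assms by simp
qed

lemma s_in_dual: "i \<in> I \<Longrightarrow> s i \<in> dual_fs V N"
  unfolding dual_fs_def
  by (auto simp: s_add s_csmul s_outside intro!: exI[of _ 1] s_le_norm)

text \<open>A Cauchy sequence converges in every coordinate \<open>s i\<close>, and
  \<open>pointwise_closed\<close> realises the limit coordinates by an element of \<open>V\<close>.
  The Cauchy estimate passes to the limit in each coordinate, and \<open>norm_le\<close> turns it
  back into a norm estimate.\<close>

lemma complete:
  assumes "\<And>n. g n \<in> V" and cauchy: "\<And>e. e > 0 \<Longrightarrow> \<exists>M::nat. \<forall>m\<ge>M. \<forall>n\<ge>M. N (g m - g n) < e"
  obtains f where "f \<in> V" "(\<lambda>n. N (g n - f)) \<longlonglongrightarrow> 0"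
proof -
  obtain M where M: "N (g m - g n) < 1" if "m \<ge> M" "n \<ge> M" for m n
    using cauchy[of 1] by auto
  \<comment> \<open>\<open>pointwise_closed\<close> concerns balls, so the sequence is followed from
    index \<open>M\<close> on, where it stays in one ball.\<close>
  let ?B = "1 + N (g M)"
  have bound: "N (g (n + M)) \<le> ?B" for n
    using norm_triangle[of "g (n + M) - g M" "g M"] M[of "n + M" M] assms(1) diff_mem[of "g (n + M)" "g M"] by simp
  let ?h = "\<lambda>f i. if i \<in> I then s i f else 0"
  have s_cauchy: "\<exists>M. \<forall>m\<ge>M. \<forall>n\<ge>M. dist (s i (g m)) (s i (g n)) < e" if "i \<in> I" "e > 0" for i e
  proof -
    obtain M where M: "N (g m - g n) < e" if "m \<ge> M" "n \<ge> M" for m n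
      using cauchy[OF \<open>e > 0\<close>] by auto
    have "dist (s i (g m)) (s i (g n)) < e" if "m \<ge> M" "n \<ge> M" for m n
      using s_le_norm[of i "g m - g n"] M[of m n] that \<open>i \<in> I\<close> assms(1)
      by (simp add: dist_norm s_diff[symmetric] diff_mem)
    then show ?thesis by blast
  qed
  have "\<exists>l. (\<lambda>n. ?h (g n) i) \<longlonglongrightarrow> l" for i
  proof (cases "i \<in> I")
    case True
    then have "Cauchy (\<lambda>n. s i (g n))"
      using s_cauchy[OF True] by (simp add: Cauchy_def)
    then show ?thesis
      using True by (simp add: Cauchy_convergent_iff convergent_def)
  qed auto
  then obtain u where u: "\<And>i. (\<lambda>n. ?h (g n) i) \<longlonglongrightarrow> u i"
    by metis
  have "(\<lambda>n. ?h (g (n + M))) \<longlonglongrightarrow> u"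
    unfolding tendsto_fun_iff using u LIMSEQ_ignore_initial_segment by blast
  moreover have "\<forall>\<^sub>F n in sequentially. ?h (g (n + M)) \<in> closure (?h ` {f \<in> V. N f \<le> ?B})"
    using assms(1) bound by (intro always_eventually allI subsetD[OF closure_subset] imageI) simp
  ultimately have "u \<in> closure (?h ` {f \<in> V. N f \<le> ?B})"
    by (intro Lim_in_closed_set[OF closed_closure]) auto
  then obtain f where f: "f \<in> V" "\<And>i. i \<in> I \<Longrightarrow> s i f = u i"
    using pointwise_closed by blast
  have lim: "(\<lambda>n. s i (g n)) \<longlonglongrightarrow> s i f" if "i \<in> I" for i
    using u[of i] that f(2) by simp
  have "(\<lambda>n. N (g n - f)) \<longlonglongrightarrow> 0"
  proof (rule LIMSEQ_I)
    fix e :: real assume "e > 0"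
    \<comment> \<open>\<open>norm_le\<close> costs the factor \<open>C\<close>; the factor 2
      restores the strict inequality that is lost in the limit.\<close>
    let ?e = "e / (2 * C)"
    have "?e > 0"
      using \<open>e > 0\<close> const_pos by simp
    then obtain M where M: "N (g m - g n) < ?e" if "m \<ge> M" "n \<ge> M" for m n
      using cauchy[OF \<open>?e > 0\<close>] by auto
    have "N (g n - f) < e" if "n \<ge> M" for n
    proof -
      have "cmod (s i (g n - f)) \<le> ?e" if "i \<in> I" for i
      proof -
        have "cmod (s i (g n) - s i f) \<le> ?e"
        proof (rule LIMSEQ_le_const2)
          show "(\<lambda>m. cmod (s i (g n) - s i (g m))) \<longlonglongrightarrow> cmod (s i (g n) - s i f)"
            by (intro tendsto_intros lim that)
          show "\<exists>N. \<forall>m\<ge>N. cmod (s i (g n) - s i (g m)) \<le> ?e"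
            using s_le_norm[OF that diff_mem[OF assms(1) assms(1)]] M[OF \<open>n \<ge> M\<close>] that assms(1)
            by (intro exI[of _ M]) (metis less_imp_le order_trans s_diff)
        qed
        then show ?thesis
          using s_diff[OF that assms(1) f(1)] by simp
      qed
      then have "N (g n - f) \<le> C * ?e"
        using f(1) assms(1) by (intro norm_le diff_mem) auto
      also have "\<dots> < e"
        using \<open>e > 0\<close> const_pos by simp
      finally show ?thesis .
    qed
    then show "\<exists>M. \<forall>n\<ge>M. norm (N (g n - f) - 0) < e"
      using norm_nonneg[OF diff_mem[OF assms(1) f(1)]] by auto
  qed
  with f(1) show ?thesis
    using that by blast
qed

section \<open>The pointwise closure of the norming functionals, and the norm attained on it\<close>

definition weak_star_closure :: "(('a \<Rightarrow> complex) \<Rightarrow> complex) set" where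
  "weak_star_closure = closure (s ` I)"

lemma s_in_closure: "i \<in> I \<Longrightarrow> s i \<in> weak_star_closure"
  unfolding weak_star_closure_def by (rule subsetD[OF closure_subset]) simp

lemma weak_star_closure_induct:
  assumes "\<gamma> \<in> weak_star_closure" and "closed {\<phi>. P \<phi>}" and "\<And>i. i \<in> I \<Longrightarrow> P (s i)"
  shows "P \<gamma>"
  using assms closure_minimal[of "s ` I" "{\<phi>. P \<phi>}"] unfolding weak_star_closure_def by auto

lemma closure_add:
  assumes "\<gamma> \<in> weak_star_closure" "f \<in> V" "g \<in> V"
  shows "\<gamma> (f + g) = \<gamma> f + \<gamma> g"
proof (rule weak_star_closure_induct[OF assms(1), where P = "\<lambda>\<phi>. \<phi> (f + g) = \<phi> f + \<phi> g"])
  show "closed {\<phi> :: ('a \<Rightarrow> complex) \<Rightarrow> complex. \<phi> (f + g) = \<phi> f + \<phi> g}"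
    by (intro closed_Collect_eq continuous_on_add continuous_on_eval)
qed (use assms in \<open>simp add: s_add\<close>)

lemma closure_csmul:
  assumes "\<gamma> \<in> weak_star_closure" "f \<in> V"
  shows "\<gamma> (csmul c f) = c * \<gamma> f"
proof (rule weak_star_closure_induct[OF assms(1), where P = "\<lambda>\<phi>. \<phi> (csmul c f) = c * \<phi> f"])
  show "closed {\<phi> :: ('a \<Rightarrow> complex) \<Rightarrow> complex. \<phi> (csmul c f) = c * \<phi> f}"
    by (intro closed_Collect_eq continuous_on_mult continuous_on_const continuous_on_eval)
qed (use assms in \<open>simp add: s_csmul\<close>)

lemma closure_outside:
  assumes "\<gamma> \<in> weak_star_closure" "f \<notin> V"
  shows "\<gamma> f = 0"
proof (rule weak_star_closure_induct[OF assms(1), where P = "\<lambda>\<phi>. \<phi> f = 0"])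
  show "closed {\<phi> :: ('a \<Rightarrow> complex) \<Rightarrow> complex. \<phi> f = 0}"
    by (intro closed_Collect_eq continuous_on_const continuous_on_eval)
qed (use assms in \<open>simp add: s_outside\<close>)

lemma closure_le_norm:
  assumes "\<gamma> \<in> weak_star_closure" "f \<in> V"
  shows "cmod (\<gamma> f) \<le> N f"
proof (rule weak_star_closure_induct[OF assms(1), where P = "\<lambda>\<phi>. cmod (\<phi> f) \<le> N f"])
  show "closed {\<phi> :: ('a \<Rightarrow> complex) \<Rightarrow> complex. cmod (\<phi> f) \<le> N f}"
    by (intro closed_Collect_le continuous_on_norm continuous_on_const continuous_on_eval)
qed (use assms in \<open>simp add: s_le_norm\<close>)

lemma closure_diff: "\<lbrakk>\<gamma> \<in> weak_star_closure; f \<in> V; g \<in> V\<rbrakk> \<Longrightarrow> \<gamma> (f - g) = \<gamma> f - \<gamma> g"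
  by (simp add: minus_eq_csmul closure_add closure_csmul csmul_mem)

lemma closure_in_dual: "\<gamma> \<in> weak_star_closure \<Longrightarrow> \<gamma> \<in> dual_fs V N"
  unfolding dual_fs_def
  by (auto simp: closure_add closure_csmul closure_outside intro!: exI[of _ 1] closure_le_norm)

text \<open>Banach-Alaoglu: the bound \<open>N f\<close> confines each value on \<open>V\<close> to
  a disc, and outside \<open>V\<close> the disc shrinks to the point 0. The closure in the product
  over all functions thus adds nothing beyond functionals on \<open>V\<close>.\<close>

lemma compact_weak_star_closure: "compact weak_star_closure"
proof -
  let ?B = "{\<gamma>. \<forall>f. \<gamma> f \<in> cball (0::complex) (if f \<in> V then N f else 0)}"
  have "compact ?B"
    by (rule compact_box_fun) simp
  moreover have "weak_star_closure \<subseteq> ?B"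
    using closure_le_norm closure_outside by auto
  ultimately show ?thesis
    using compact_Int_closed[of ?B weak_star_closure] unfolding weak_star_closure_def
    by (simp add: Int_absorb1)
qed

text \<open>Simons' argument needs a norm that is attained at some functional of the closure.
  \<open>N\<close> itself need not have this property, since it is only equivalent to the supremum
  over the family; \<open>snorm\<close> lies between \<open>N / C\<close> and
  \<open>N\<close>.\<close>

definition snorm :: "('a \<Rightarrow> complex) \<Rightarrow> real" where
  "snorm f = (SUP \<gamma>\<in>weak_star_closure. cmod (\<gamma> f))"

lemma snorm_attained:
  assumes "f \<in> V"
  obtains \<gamma> where "\<gamma> \<in> weak_star_closure" "snorm f = cmod (\<gamma> f)"
proof -
  have "weak_star_closure \<noteq> {}"
    using s_in_closure index_nonempty by blast
  then obtain \<gamma> where \<gamma>: "\<gamma> \<in> weak_star_closure" "\<And>\<gamma>'. \<gamma>' \<in> weak_star_closure \<Longrightarrow> cmod (\<gamma>' f) \<le> cmod (\<gamma> f)"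
    using continuous_attains_sup[OF compact_weak_star_closure _ continuous_on_norm[OF continuous_on_eval]]
    by meson
  have "snorm f = cmod (\<gamma> f)"
    unfolding snorm_def using \<gamma> by (intro cSup_eq_maximum) auto
  with \<gamma>(1) show ?thesis
    using that by blast
qed

lemma closure_le_snorm:
  assumes "\<gamma> \<in> weak_star_closure" "f \<in> V"
  shows "cmod (\<gamma> f) \<le> snorm f"
  unfolding snorm_def using assms closure_le_norm by (intro cSUP_upper) (auto intro!: bdd_aboveI2)

lemma snorm_triangle:
  assumes "f \<in> V" "g \<in> V"
  shows "snorm (f + g) \<le> snorm f + snorm g"
proof -
  obtain \<gamma> where \<gamma>: "\<gamma> \<in> weak_star_closure" "snorm (f + g) = cmod (\<gamma> (f + g))"
    using snorm_attained[OF add_mem[OF assms]] .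
  then have "snorm (f + g) \<le> cmod (\<gamma> f) + cmod (\<gamma> g)"
    using assms by (simp add: closure_add norm_triangle_ineq)
  then show ?thesis
    using closure_le_snorm[OF \<gamma>(1)] assms by (smt (verit))
qed

lemma snorm_csmul:
  assumes "f \<in> V"
  shows "snorm (csmul c f) = cmod c * snorm f"
proof (rule antisym)
  obtain \<gamma> where \<gamma>: "\<gamma> \<in> weak_star_closure" "snorm (csmul c f) = cmod (\<gamma> (csmul c f))"
    using snorm_attained[OF csmul_mem[OF assms]] .
  then show "snorm (csmul c f) \<le> cmod c * snorm f"
    using closure_le_snorm[OF \<gamma>(1) assms] assms by (simp add: closure_csmul norm_mult mult_left_mono)
next
  obtain \<gamma> where \<gamma>: "\<gamma> \<in> weak_star_closure" "snorm f = cmod (\<gamma> f)"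
    using snorm_attained[OF assms] .
  then show "cmod c * snorm f \<le> snorm (csmul c f)"
    using closure_le_snorm[OF \<gamma>(1) csmul_mem[OF assms, of c]] assms by (simp add: closure_csmul norm_mult)
qed

lemma snorm_nonneg:
  assumes "f \<in> V" shows "0 \<le> snorm f"
  using snorm_attained[OF assms] by (metis norm_ge_zero)

lemma norm_le_snorm:
  assumes "f \<in> V" shows "N f \<le> C * snorm f"
  using assms s_in_closure closure_le_snorm by (intro norm_le) auto

end

subsection \<open>Simons' argument\<close>

lemma dual_fs_bound:
  assumes "\<psi> \<in> dual_fs V N" and "\<And>f. f \<in> V \<Longrightarrow> 0 \<le> N f"
  obtains D where "D > 0" "\<And>f. f \<in> V \<Longrightarrow> cmod (\<psi> f) \<le> D * N f"
proof -
  obtain D where D: "\<And>f. f \<in> V \<Longrightarrow> cmod (\<psi> f) \<le> D * N f"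
    using assms(1) unfolding dual_fs_def by blast
  have "cmod (\<psi> f) \<le> max D 1 * N f" if "f \<in> V" for f
    using D[OF that] mult_right_mono[of D "max D 1" "N f"] assms(2)[OF that] by simp
  then show ?thesis
    using that[of "max D 1"] by simp
qed

context norming_family
begin

lemma dual_add: "\<lbrakk>\<psi> \<in> dual_fs V N; f \<in> V; g \<in> V\<rbrakk> \<Longrightarrow> \<psi> (f + g) = \<psi> f + \<psi> g"
  by (simp add: dual_fs_def)

lemma dual_csmul: "\<lbrakk>\<psi> \<in> dual_fs V N; f \<in> V\<rbrakk> \<Longrightarrow> \<psi> (csmul c f) = c * \<psi> f"
  by (simp add: dual_fs_def)

lemma dual_diff: "\<lbrakk>\<psi> \<in> dual_fs V N; f \<in> V; g \<in> V\<rbrakk> \<Longrightarrow> \<psi> (f - g) = \<psi> f - \<psi> g"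
  by (simp add: minus_eq_csmul dual_add dual_csmul csmul_mem)

lemma dual_zero: "\<psi> \<in> dual_fs V N \<Longrightarrow> \<psi> 0 = 0"
  using dual_diff[of \<psi> 0 0] zero_mem by simp

lemma dual_tendsto:
  assumes \<psi>: "\<psi> \<in> dual_fs V N" and "\<And>n. g n \<in> V" "f \<in> V" and lim: "(\<lambda>n. N (g n - f)) \<longlonglongrightarrow> 0"
  shows "(\<lambda>n. \<psi> (g n)) \<longlonglongrightarrow> \<psi> f"
proof -
  obtain D where D: "D > 0" "\<And>f. f \<in> V \<Longrightarrow> cmod (\<psi> f) \<le> D * N f"
    using dual_fs_bound[OF \<psi> norm_nonneg] by blast
  have "(\<lambda>n. \<psi> (g n) - \<psi> f) \<longlonglongrightarrow> 0"
  proof (rule Lim_null_comparison)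
    show "\<forall>\<^sub>F n in sequentially. norm (\<psi> (g n) - \<psi> f) \<le> D * N (g n - f)"
      using D(2)[OF diff_mem] assms by (auto simp: dual_diff[symmetric])
    show "(\<lambda>n. D * N (g n - f)) \<longlonglongrightarrow> 0"
      using tendsto_mult_left[OF lim, of D] by simp
  qed
  then show ?thesis
    by (simp add: LIM_zero_iff)
qed

text \<open>Simons' argument: the set \<open>T n\<close> below plays the role of the closed convex hull of the tail
  \<open>g n, g (n + 1), \<dots>\<close>; the vectors \<open>y n \<in> T n\<close> are chosen greedily so that the functional at which
  \<open>w = \<Sum>n. y n / 2 ^ (n + 1)\<close> attains its norm stays away from \<open>0\<close> on every \<open>T n\<close>.\<close>
lemma simons_contradiction:
  assumes \<psi>: "\<psi> \<in> dual_fs V N" and g: "\<And>n. g n \<in> V" and bound: "\<And>n. N (g n) \<le> B"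
    and \<delta>: "\<delta> > 0" "\<And>n. \<delta> \<le> Re (\<psi> (g n))"
    and null: "\<And>\<gamma>. \<gamma> \<in> weak_star_closure \<Longrightarrow> (\<lambda>n. \<gamma> (g n)) \<longlonglongrightarrow> 0"
  shows False
proof -
  define sc where "sc = (\<lambda>r::real. csmul (complex_of_real r) :: ('a \<Rightarrow> complex) \<Rightarrow> ('a \<Rightarrow> complex))"
  have sc_apply [simp]: "sc r f x = of_real r * f x" for r f x
    by (simp add: sc_def)
  have sc_mem: "f \<in> V \<Longrightarrow> sc r f \<in> V" for r f
    by (simp add: sc_def csmul_mem)
  have sc_N: "f \<in> V \<Longrightarrow> N (sc r f) = \<bar>r\<bar> * N f" for r f
    by (simp add: sc_def norm_csmul)
  have sc_p: "f \<in> V \<Longrightarrow> snorm (sc r f) = \<bar>r\<bar> * snorm f" for r f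
    by (simp add: sc_def snorm_csmul)
  have sc_dual: "f \<in> V \<Longrightarrow> \<phi> \<in> dual_fs V N \<Longrightarrow> \<phi> (sc r f) = of_real r * \<phi> f" for r f \<phi>
    by (simp add: sc_def dual_csmul)
  have "B \<ge> 0"
    using norm_nonneg[OF g] bound order_trans by blast
  obtain D where D: "D > 0" "\<And>f. f \<in> V \<Longrightarrow> cmod (\<psi> f) \<le> D * N f"
    using dual_fs_bound[OF \<psi> norm_nonneg] by blast
  \<comment> \<open>No hull is formed. \<open>T n\<close> collects the inequalities that hold on the
    tail and survive convex combinations and norm limits; the argument uses nothing else about the
    hull.\<close>
  define T where "T n = {h \<in> V. N h \<le> B \<and> \<delta> \<le> Re (\<psi> h) \<and>
      (\<forall>\<gamma>\<in>weak_star_closure. \<forall>e. (\<forall>k\<ge>n. cmod (\<gamma> (g k)) \<le> e) \<longrightarrow> cmod (\<gamma> h) \<le> e)}" for n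
  \<comment> \<open>For \<open>h\<close> in \<open>T n\<close> one has \<delta> \<le> |\<psi> h|
    \<le> \<open>D * N h\<close> \<le> \<open>D * C * snorm h\<close>, so \<open>m\<close> is a
    lower bound of \<open>snorm\<close> on every \<open>T n\<close>.\<close>
  define m where "m = \<delta> / (D * C)"
  have "m > 0"
    using \<delta> D const_pos by (simp add: m_def)
  have m_le: "m \<le> snorm h" if "h \<in> T n" for h n
  proof -
    have "h \<in> V" and "\<delta> \<le> Re (\<psi> h)"
      using that by (auto simp: T_def)
    have "\<delta> \<le> cmod (\<psi> h)"
      using \<open>\<delta> \<le> Re (\<psi> h)\<close> complex_Re_le_cmod order_trans by blast
    also have "\<dots> \<le> D * N h"
      using D \<open>h \<in> V\<close> by blast
    also have "\<dots> \<le> D * (C * snorm h)"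
      using D norm_le_snorm[OF \<open>h \<in> V\<close>] by (intro mult_left_mono) auto
    finally show ?thesis
      using D const_pos by (simp add: m_def field_simps)
  qed
  have T_V: "T n \<subseteq> V" for n
    by (auto simp: T_def)
  have "g n \<in> T n" for n
    using g bound \<delta> by (auto simp: T_def)
  \<comment> \<open>The infimum need not be attained, so an error is allowed. It decays like
    \<open>(1/4)^n\<close> because the final estimate is multiplied by \<open>2^n\<close>; the
    accumulated error is then at most \<open>m/2\<close>, half of the lower bound for
    \<open>snorm w\<close>.\<close>
  have greedy: "\<exists>y. y \<in> T n \<and> (\<forall>y'\<in>T n. snorm (f + sc ((1/2)^n) y) \<le> snorm (f + sc ((1/2)^n) y') + m/4 * (1/4)^n)"
    if "f \<in> V" for f n
  proof -
    let ?P = "\<lambda>y. snorm (f + sc ((1/2)^n) y)"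
    have ne: "?P ` T n \<noteq> {}"
      using \<open>g n \<in> T n\<close> by blast
    have bdd: "bdd_below (?P ` T n)"
      using that T_V by (intro bdd_belowI2[of _ 0] snorm_nonneg add_mem sc_mem) auto
    have "Inf (?P ` T n) < Inf (?P ` T n) + m/4 * (1/4)^n"
      using \<open>m > 0\<close> by simp
    then obtain y where "y \<in> T n" "?P y < Inf (?P ` T n) + m/4 * (1/4)^n"
      using cInf_lessD[OF ne] by blast
    moreover have "Inf (?P ` T n) \<le> ?P y'" if "y' \<in> T n" for y'
      using bdd that by (intro cInf_lower) auto
    ultimately show ?thesis
      by (smt (verit))
  qed
  define Y where "Y n f = (SOME y. y \<in> T n \<and>
      (\<forall>y'\<in>T n. snorm (f + sc ((1/2)^n) y) \<le> snorm (f + sc ((1/2)^n) y') + m/4 * (1/4)^n))" for n f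
  \<comment> \<open>The step adds \<open>y\<close> with weight \<open>(1/2)^(Suc n)\<close>,
    although \<open>y\<close> was chosen for the weight \<open>(1/2)^n\<close>. The latter is the
    total weight of all terms still to come, so the limit \<open>w\<close> will have the form
    \<open>z n + sc ((1/2)^n) (u n)\<close> and compete in the minimisation at every stage.\<close>
  define z where "z = rec_nat 0 (\<lambda>n f. f + sc ((1/2)^(Suc n)) (Y n f))"
  define y where "y n = Y n (z n)" for n
  have z_0: "z 0 = 0" and z_Suc: "z (Suc n) = z n + sc ((1/2)^(Suc n)) (y n)" for n
    by (simp_all add: z_def y_def)
  have y_props: "y n \<in> T n \<and> (\<forall>y'\<in>T n. snorm (z n + sc ((1/2)^n) (y n)) \<le> snorm (z n + sc ((1/2)^n) y') + m/4 * (1/4)^n)"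
    if "z n \<in> V" for n
    unfolding y_def Y_def by (rule someI_ex[OF greedy[OF that]])
  have z_V: "z n \<in> V" for n
  proof (induction n)
    case (Suc n)
    then show ?case
      unfolding z_Suc using y_props[OF Suc] T_V by (intro add_mem sc_mem) auto
  qed (simp only: z_0 zero_mem)
  have y_T: "y n \<in> T n" and y_min: "y' \<in> T n \<Longrightarrow> snorm (z n + sc ((1/2)^n) (y n)) \<le> snorm (z n + sc ((1/2)^n) y') + m/4 * (1/4)^n" for n y'
    using y_props[OF z_V] by auto
  have y_V: "y n \<in> V" for n
    using y_T T_V by auto
  \<comment> \<open>The next \<open>k\<close> terms after \<open>z n\<close>, rescaled: their
    weights are 1/2, 1/4, ... and sum to \<open>1 - (1/2)^k\<close>. This factor appears in the
    three bounds below and tends to 1.\<close>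
  define d where "d n k = sc (2^n) (z (n + k) - z n)" for n k
  have d_V: "d n k \<in> V" for n k
    by (simp add: d_def sc_mem diff_mem z_V)
  have d_0: "d n 0 = 0" for n
    by (auto simp: d_def fun_eq_iff)
  have d_Suc: "d n (Suc k) = d n k + sc ((1/2)^(Suc k)) (y (n + k))" for n k
    by (auto simp: d_def z_Suc fun_eq_iff algebra_simps power_add power_one_over field_simps)
  have d_N: "N (d n k) \<le> (1 - (1/2)^k) * B" for n k
  proof (induction k)
    case (Suc k)
    have "N (d n (Suc k)) \<le> N (d n k) + (1/2)^(Suc k) * N (y (n + k))"
      unfolding d_Suc using norm_triangle[OF d_V[of n k] sc_mem[OF y_V, of "(1/2)^(Suc k)" "n + k"]]
      by (simp add: sc_N y_V)
    also have "\<dots> \<le> (1 - (1/2)^k) * B + (1/2)^(Suc k) * B"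
      using Suc y_T[of "n + k"] by (intro add_mono mult_left_mono) (auto simp: T_def)
    finally show ?case
      by (simp add: algebra_simps)
  qed (simp only: d_0 local.norm_zero, simp)
  have d_\<psi>: "(1 - (1/2)^k) * \<delta> \<le> Re (\<psi> (d n k))" for n k
  proof (induction k)
    case (Suc k)
    have "Re (\<psi> (d n (Suc k))) = Re (\<psi> (d n k)) + (1/2)^(Suc k) * Re (\<psi> (y (n + k)))"
      unfolding d_Suc by (simp add: dual_add[OF \<psi> d_V sc_mem[OF y_V]] sc_dual[OF y_V \<psi>] del: power_Suc)
    moreover have "(1/2)^(Suc k) * \<delta> \<le> (1/2)^(Suc k) * Re (\<psi> (y (n + k)))"
      using y_T[of "n + k"] by (intro mult_left_mono) (auto simp: T_def)
    moreover have "(1 - (1/2)^(Suc k)) * \<delta> = (1 - (1/2)^k) * \<delta> + (1/2)^(Suc k) * \<delta>"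
      by (simp add: algebra_simps)
    ultimately show ?case
      using Suc by linarith
  qed (simp only: d_0 dual_zero[OF \<psi>], simp)
  have d_\<gamma>: "cmod (\<gamma> (d n k)) \<le> (1 - (1/2)^k) * e"
    if "\<gamma> \<in> weak_star_closure" and e: "\<forall>k\<ge>n. cmod (\<gamma> (g k)) \<le> e" for \<gamma> n k e
  proof (induction k)
    case (Suc k)
    have \<gamma>: "\<gamma> \<in> dual_fs V N"
      using that closure_in_dual by blast
    have "cmod (\<gamma> (d n (Suc k))) \<le> cmod (\<gamma> (d n k)) + cmod (of_real ((1/2)^(Suc k)) * \<gamma> (y (n + k)))"
      unfolding d_Suc dual_add[OF \<gamma> d_V sc_mem[OF y_V]] sc_dual[OF y_V \<gamma>] by (rule norm_triangle_ineq)
    also have "\<dots> = cmod (\<gamma> (d n k)) + (1/2)^(Suc k) * cmod (\<gamma> (y (n + k)))"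
      by (simp add: norm_mult norm_power)
    also have "\<dots> \<le> (1 - (1/2)^k) * e + (1/2)^(Suc k) * e"
      using Suc y_T[of "n + k"] that by (intro add_mono mult_left_mono) (auto simp: T_def)
    finally show ?case
      by (simp add: algebra_simps)
  qed (simp only: d_0 dual_zero[OF closure_in_dual[OF that(1)]], simp)
  have z_near: "N (z (n + k) - z n) \<le> (1/2)^n * B" for n k
  proof -
    have "2^n * N (z (n + k) - z n) = N (d n k)"
      by (simp add: d_def sc_N diff_mem z_V)
    also have "\<dots> \<le> 1 * B"
      using d_N[of n k] mult_right_mono[of "1 - (1/2)^k" 1 B] \<open>B \<ge> 0\<close> by simp
    finally show ?thesis
      by (simp add: field_simps power_one_over)
  qed
  have "\<exists>M. \<forall>m\<ge>M. \<forall>n\<ge>M. N (z m - z n) < e" if "e > 0" for e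
  proof -
    have "(\<lambda>n. (1/2)^n * B) \<longlonglongrightarrow> 0"
      by (intro tendsto_mult_left_zero LIMSEQ_power_zero) simp
    then obtain M where M: "(1/2)^M * B < e/2"
      using order_tendstoD(2)[of _ 0 sequentially "e/2"] \<open>e > 0\<close> by (auto simp: eventually_sequentially)
    have "N (z m - z n) < e" if "m \<ge> M" "n \<ge> M" for m n
      using norm_diff_triangle[OF z_V[of m] z_V[of M] z_V[of n]] norm_minus_commute[OF z_V[of M] z_V[of n]]
        z_near[of M "m - M"] z_near[of M "n - M"] M that by simp
    then show ?thesis by blast
  qed
  then obtain w where w: "w \<in> V" and w_lim: "(\<lambda>n. N (z n - w)) \<longlonglongrightarrow> 0"
    using complete[of z] z_V by metis
  define u where "u n = sc (2^n) (w - z n)" for n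
  have u_V: "u n \<in> V" for n
    by (simp add: u_def sc_mem diff_mem z_V w)
  have du: "(\<lambda>k. N (d n k - u n)) \<longlonglongrightarrow> 0" for n
  proof -
    have "d n k - u n = sc (2^n) (z (k + n) - w)" for k
      by (auto simp: d_def u_def fun_eq_iff algebra_simps)
    then have "N (d n k - u n) = 2^n * N (z (k + n) - w)" for k
      by (simp add: sc_N diff_mem z_V w)
    then show ?thesis
      using tendsto_mult_left[OF LIMSEQ_ignore_initial_segment[OF w_lim, of n], of "2^n"] by simp
  qed
  have half: "(\<lambda>k. (1 - (1/2)^k) * x) \<longlonglongrightarrow> x" for x :: real
  proof -
    have "(\<lambda>k. (1 - (1/2)^k) * x) \<longlonglongrightarrow> (1 - 0) * x"
      by (intro tendsto_intros LIMSEQ_power_zero) simp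
    then show ?thesis by simp
  qed
  \<comment> \<open>\<open>u n\<close> is the norm limit of \<open>d n k\<close>, and each defining
    inequality of \<open>T n\<close> is closed, so the bounds on \<open>d n k\<close> pass to the
    limit.\<close>
  have u_T: "u n \<in> T n" for n
  proof -
    have "N (u n) \<le> B"
    proof (rule LIMSEQ_le_const)
      show "(\<lambda>k. B + N (d n k - u n)) \<longlonglongrightarrow> B"
        using tendsto_add[OF tendsto_const du[of n], of B] by simp
      have "N (u n) \<le> B + N (d n k - u n)" for k
        using norm_triangle[OF d_V[of n k] diff_mem[OF u_V[of n] d_V[of n k]]] d_N[of n k] \<open>B \<ge> 0\<close>
          norm_minus_commute[OF u_V[of n] d_V[of n k]] mult_right_mono[of "1 - (1/2)^k" 1 B] by simp
      then show "\<exists>M. \<forall>k\<ge>M. N (u n) \<le> B + N (d n k - u n)"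
        by blast
    qed
    moreover have "\<delta> \<le> Re (\<psi> (u n))"
      using d_\<psi> by (intro LIMSEQ_le[OF half tendsto_Re[OF dual_tendsto[OF \<psi> d_V u_V du]]]) auto
    moreover have "cmod (\<gamma> (u n)) \<le> e"
      if "\<gamma> \<in> weak_star_closure" "\<forall>k\<ge>n. cmod (\<gamma> (g k)) \<le> e" for \<gamma> e
      using d_\<gamma>[OF that]
      by (intro LIMSEQ_le[OF tendsto_norm[OF dual_tendsto[OF closure_in_dual[OF that(1)] d_V u_V du]] half]) auto
    ultimately show ?thesis
      using u_V by (simp add: T_def)
  qed
  \<comment> \<open>\<open>z (Suc n)\<close> is the midpoint of \<open>z n\<close> and
    \<open>z n + sc ((1/2)^n) (y n)\<close>. Comparing \<open>y n\<close> with the competitor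
    \<open>u n\<close> bounds the second point by \<open>snorm w\<close> plus the greedy error. The
    last summand solves the resulting recursion for the errors.\<close>
  have p_z: "snorm (z n) \<le> (1 - (1/2)^n) * snorm w + (1/2)^n * (m/4) * (2 - 2 * (1/2)^n)" for n
  proof (induction n)
    case 0
    have "sc 0 0 = 0"
      by (auto simp: fun_eq_iff)
    then have "snorm 0 = 0"
      using sc_p[OF zero_mem, of 0] by simp
    then show ?case
      by (simp only: z_0) simp
  next
    case (Suc n)
    have "z n + sc ((1/2)^n) (u n) = w"
      by (auto simp: u_def fun_eq_iff power_one_over)
    then have *: "snorm (z n + sc ((1/2)^n) (y n)) \<le> snorm w + m/4 * (1/4)^n"
      using y_min[OF u_T[of n]] by simp
    have "z (Suc n) = sc (1/2) (z n) + sc (1/2) (z n + sc ((1/2)^n) (y n))"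
      by (auto simp: z_Suc fun_eq_iff algebra_simps)
    then have "snorm (z (Suc n)) \<le> snorm (sc (1/2) (z n)) + snorm (sc (1/2) (z n + sc ((1/2)^n) (y n)))"
      by (simp add: snorm_triangle sc_mem add_mem z_V y_V)
    also have "\<dots> = 1/2 * snorm (z n) + 1/2 * snorm (z n + sc ((1/2)^n) (y n))"
      by (simp add: sc_p sc_mem add_mem z_V y_V)
    also have "\<dots> \<le> 1/2 * ((1 - (1/2)^n) * snorm w + (1/2)^n * (m/4) * (2 - 2 * (1/2)^n)) + 1/2 * (snorm w + m/4 * (1/4)^n)"
      using Suc * by (intro add_mono mult_left_mono) auto
    also have "\<dots> = (1 - (1/2)^(Suc n)) * snorm w + (1/2)^(Suc n) * (m/4) * (2 - 2 * (1/2)^(Suc n))"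
    proof -
      have "(1/4::real)^n = (1/2)^n * (1/2)^n"
        by (simp flip: power_mult_distrib)
      then show ?thesis
        by (simp add: algebra_simps diff_divide_distrib)
    qed
    finally show ?case .
  qed
  obtain \<gamma> where \<gamma>: "\<gamma> \<in> weak_star_closure" "snorm w = cmod (\<gamma> w)"
    using snorm_attained[OF w] .
  have "m \<le> snorm w"
  proof -
    have "u 0 = w"
      by (auto simp: u_def z_0 fun_eq_iff)
    then show ?thesis
      using m_le[OF u_T[of 0]] by simp
  qed
  \<comment> \<open>Since \<gamma> attains the norm of \<open>w\<close> but is at most
    \<open>snorm (z n)\<close> on \<open>z n\<close>, \<open>p_z\<close> keeps its value on
    \<open>w - z n\<close> above \<open>(1/2)^n * (snorm w - m/2)\<close>. The factor
    \<open>2^n\<close> in \<open>u n\<close> cancels the decay.\<close>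
  have large: "m/2 \<le> cmod (\<gamma> (u n))" for n
  proof -
    have "cmod (\<gamma> (u n)) = 2^n * cmod (\<gamma> w - \<gamma> (z n))"
      unfolding u_def by (simp add: sc_dual diff_mem w z_V closure_in_dual \<gamma> closure_diff norm_mult norm_power)
    moreover have "cmod (\<gamma> w) - cmod (\<gamma> (z n)) \<le> cmod (\<gamma> w - \<gamma> (z n))"
      by (rule norm_triangle_ineq2)
    moreover have "cmod (\<gamma> (z n)) \<le> snorm (z n)"
      by (rule closure_le_snorm[OF \<gamma>(1) z_V])
    ultimately have "2^n * (snorm w - snorm (z n)) \<le> cmod (\<gamma> (u n))"
      using \<gamma>(2) by simp
    moreover have "(1/2)^n * (snorm w - m/4 * (2 - 2 * (1/2)^n)) \<le> snorm w - snorm (z n)"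
      using p_z[of n] by (simp add: algebra_simps)
    then have "2^n * ((1/2)^n * (snorm w - m/4 * (2 - 2 * (1/2)^n))) \<le> 2^n * (snorm w - snorm (z n))"
      by (intro mult_left_mono) auto
    then have "snorm w - m/4 * (2 - 2 * (1/2)^n) \<le> 2^n * (snorm w - snorm (z n))"
      by (simp add: power_one_over)
    moreover have "m/4 * (2 - 2 * (1/2)^n) \<le> m/4 * 2"
      using \<open>m > 0\<close> by (intro mult_left_mono) auto
    ultimately show ?thesis
      using \<open>m \<le> snorm w\<close> by linarith
  qed
  \<comment> \<open>This \<gamma> is one fixed functional, so its decay along \<open>g\<close> is
    eventually below \<open>m/4\<close>; membership of \<open>u n\<close> in \<open>T n\<close>
    transfers the bound to \<open>u n\<close>.\<close>
  obtain n where "\<forall>k\<ge>n. cmod (\<gamma> (g k)) \<le> m/4"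
    using LIMSEQ_D[OF null[OF \<gamma>(1)], of "m/4"] \<open>m > 0\<close> by (auto intro: less_imp_le)
  then have "cmod (\<gamma> (u n)) \<le> m/4"
    using u_T[of n] \<gamma>(1) unfolding T_def by blast
  then show False
    using large[of n] \<open>m > 0\<close> by simp
qed

text \<open>A statement in the spirit of Rainwater's theorem. If it failed for \<psi>, some
  subsequence would keep |\<psi>| above a positive \<delta>; multiplying its terms by scalars of
  modulus one makes the values of \<psi> positive real without disturbing boundedness or the null
  limits, and Simons' argument applies.\<close>

lemma weakly_null_if_null_on_closure:
  assumes \<psi>: "\<psi> \<in> dual_fs V N" and g: "\<And>n. g n \<in> V" and bound: "\<And>n. N (g n) \<le> B"
    and null: "\<And>\<gamma>. \<gamma> \<in> weak_star_closure \<Longrightarrow> (\<lambda>n. \<gamma> (g n)) \<longlonglongrightarrow> 0"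
  shows "(\<lambda>n. \<psi> (g n)) \<longlonglongrightarrow> 0"
proof (rule ccontr)
  assume "\<not> (\<lambda>n. \<psi> (g n)) \<longlonglongrightarrow> 0"
  then obtain \<delta> where "\<delta> > 0" and "\<forall>M. \<exists>n\<ge>M. \<delta> \<le> cmod (\<psi> (g n))"
    unfolding LIMSEQ_iff by (auto simp: not_less)
  then have "infinite {n. \<delta> \<le> cmod (\<psi> (g n))}"
    unfolding infinite_nat_iff_unbounded_le by auto
  then obtain r :: "nat \<Rightarrow> nat" where r: "strict_mono r" "\<And>n. \<delta> \<le> cmod (\<psi> (g (r n)))"
    using infinite_enumerate[of "{n. \<delta> \<le> cmod (\<psi> (g n))}"] by auto
  define c where "c n = cnj (sgn (\<psi> (g (r n))))" for n
  have c_le: "cmod (c n) \<le> 1" for n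
    by (simp add: c_def norm_sgn)
  have c_eq: "Re (c n * \<psi> (g (r n))) = cmod (\<psi> (g (r n)))" for n
  proof -
    have "cnj (sgn a) * a = of_real (cmod a)" for a
      using complex_norm_square[of a]
      by (cases "a = 0") (simp_all add: sgn_eq power2_eq_square field_simps)
    then show ?thesis
      by (simp add: c_def)
  qed
  show False
  proof (rule simons_contradiction[OF \<psi>, where g = "\<lambda>n. csmul (c n) (g (r n))"])
    show "N (csmul (c n) (g (r n))) \<le> B" for n
      using mult_mono[OF c_le[of n] bound[of "r n"]] norm_nonneg[OF g] by (simp add: norm_csmul g)
    show "\<delta> \<le> Re (\<psi> (csmul (c n) (g (r n))))" for n
      using r(2)[of n] by (simp only: dual_csmul[OF \<psi> g] c_eq)
    fix \<gamma> assume \<gamma>: "\<gamma> \<in> weak_star_closure"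
    have lim: "(\<lambda>n. \<gamma> (g (r n))) \<longlonglongrightarrow> 0"
      using LIMSEQ_subseq_LIMSEQ[OF null[OF \<gamma>] r(1)] by (simp add: o_def)
    show "(\<lambda>n. \<gamma> (csmul (c n) (g (r n)))) \<longlonglongrightarrow> 0"
    proof (rule Lim_null_comparison[OF _ tendsto_norm_zero[OF lim]])
      show "\<forall>\<^sub>F n in sequentially. norm (\<gamma> (csmul (c n) (g (r n)))) \<le> cmod (\<gamma> (g (r n)))"
        using c_le by (simp add: closure_csmul[OF \<gamma> g] norm_mult mult_left_le_one_le)
    qed
  qed (simp_all add: csmul_mem g \<open>\<delta> > 0\<close>)
qed

end

subsection \<open>Norm topology and weak separability\<close>

context norming_family
begin

text \<open>The value 0 off \<open>V\<close> makes the function symmetric and nonnegative for all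
  arguments, as \<open>Metric_space\<close> demands, whatever \<open>N\<close> does outside
  \<open>V\<close>.\<close>

definition norm_dist :: "('a \<Rightarrow> complex) \<Rightarrow> ('a \<Rightarrow> complex) \<Rightarrow> real" where
  "norm_dist f g = (if f \<in> V \<and> g \<in> V then N (f - g) else 0)"

lemma Metric_space_norm_dist: "Metric_space V norm_dist"
proof
  fix f g
  show "0 \<le> norm_dist f g"
    by (simp add: norm_dist_def norm_nonneg diff_mem)
  show "norm_dist f g = norm_dist g f"
    using norm_minus_commute by (simp add: norm_dist_def)
  show "norm_dist f g = 0 \<longleftrightarrow> f = g" if "f \<in> V" "g \<in> V"
    using that norm_eq_0[OF diff_mem[OF that]] local.norm_zero by (auto simp: norm_dist_def)
  show "norm_dist f h \<le> norm_dist f g + norm_dist g h" if "f \<in> V" "g \<in> V" "h \<in> V" for h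
    using norm_diff_triangle that by (simp add: norm_dist_def)
qed

sublocale M: Metric_space V norm_dist
  by (rule Metric_space_norm_dist)

lemma norm_top_fs_eq: "norm_top_fs V N = M.mtopology"
proof -
  let ?\<B> = "{{g \<in> V. N (g - f) < r} | f r. f \<in> V}"
  have ball: "{g \<in> V. N (g - f) < r} = M.mball f r" if "f \<in> V" for f r
    using that norm_minus_commute by (auto simp: norm_dist_def)
  have "openin (norm_top_fs V N) U" if U: "openin M.mtopology U" for U
  proof (subst openin_subopen, intro ballI)
    fix x assume "x \<in> U"
    then obtain r where "r > 0" and r: "M.mball x r \<subseteq> U" and "x \<in> V"
      using U unfolding M.openin_mtopology by blast
    have "openin (norm_top_fs V N) {g \<in> V. N (g - x) < r}"
      unfolding norm_top_fs_def by (rule topology_generated_by_Basis) (use \<open>x \<in> V\<close> in blast)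
    then show "\<exists>T. openin (norm_top_fs V N) T \<and> x \<in> T \<and> T \<subseteq> U"
      using r \<open>r > 0\<close> \<open>x \<in> V\<close> ball[OF \<open>x \<in> V\<close>] by (metis M.centre_in_mball_iff)
  qed
  moreover have "openin M.mtopology U" if "openin (norm_top_fs V N) U" for U
  proof -
    have "generate_topology_on ?\<B> U"
      using that by (simp add: norm_top_fs_def openin_topology_generated_by_iff)
    then show ?thesis
    proof induction
      case (Basis s)
      then show ?case
        using ball by (auto simp: M.openin_mball)
    qed auto
  qed
  ultimately show ?thesis
    by (metis topology_eq)
qed

lemma mcomplete_norm_dist: "M.mcomplete"
  unfolding M.mcomplete_def
proof (intro allI impI)
  fix \<sigma> :: "nat \<Rightarrow> 'a \<Rightarrow> complex" assume \<sigma>: "M.MCauchy \<sigma>"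
  then have V: "\<sigma> n \<in> V" for n
    by (auto simp: M.MCauchy_def)
  have "\<exists>M. \<forall>m\<ge>M. \<forall>n\<ge>M. N (\<sigma> m - \<sigma> n) < e" if "e > 0" for e
    using \<sigma> that V unfolding M.MCauchy_def norm_dist_def by auto
  then obtain f where f: "f \<in> V" "(\<lambda>n. N (\<sigma> n - f)) \<longlonglongrightarrow> 0"
    using complete[of \<sigma>] V by metis
  have "limitin M.mtopology \<sigma> f sequentially"
    using f V order_tendstoD(2)[OF f(2)] by (auto simp: M.limitin_metric norm_dist_def)
  then show "\<exists>x. limitin M.mtopology \<sigma> x sequentially"
    by blast
qed

lemma rel_compact_norm_top_iff:
  assumes "S \<subseteq> V"
  shows "rel_compact_in (norm_top_fs V N) S \<longleftrightarrow>
    (\<forall>e>0. \<exists>F. finite F \<and> F \<subseteq> S \<and> (\<forall>f\<in>S. \<exists>g\<in>F. N (f - g) < e))"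
proof -
  have "rel_compact_in (norm_top_fs V N) S \<longleftrightarrow> M.mtotally_bounded S"
    using assms by (simp add: rel_compact_in_def norm_top_fs_eq M.mtotally_bounded_eq_compact_closure_of[OF mcomplete_norm_dist])
  also have "\<dots> \<longleftrightarrow> (\<forall>e>0. \<exists>F. finite F \<and> F \<subseteq> S \<and> S \<subseteq> (\<Union>x\<in>F. M.mball x e))"
    unfolding M.mtotally_bounded_def by simp
  also have "\<dots> \<longleftrightarrow> (\<forall>e>0. \<exists>F. finite F \<and> F \<subseteq> S \<and> (\<forall>f\<in>S. \<exists>g\<in>F. N (f - g) < e))"
  proof -
    have "S \<subseteq> (\<Union>x\<in>F. M.mball x e) \<longleftrightarrow> (\<forall>f\<in>S. \<exists>g\<in>F. N (f - g) < e)" if "F \<subseteq> S" for F e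
    proof -
      have "f \<in> M.mball g e \<longleftrightarrow> N (f - g) < e" if "f \<in> S" "g \<in> F" for f g
        using that \<open>F \<subseteq> S\<close> assms norm_minus_commute[of f g] by (auto simp: norm_dist_def subset_iff)
      then show ?thesis by blast
    qed
    then show ?thesis by (metis (no_types, lifting))
  qed
  finally show ?thesis .
qed

lemma topspace_norm_top_fs: "topspace (norm_top_fs V N) = V"
  by (simp add: norm_top_fs_eq)

lemma Hausdorff_norm_top_fs: "Hausdorff_space (norm_top_fs V N)"
  by (simp add: norm_top_fs_eq M.Hausdorff_space_mtopology)

lemma Hausdorff_weak_top: "Hausdorff_space (weak_top_fs V N)"
  using s_separates s_in_dual by (intro Hausdorff_weak_top_fs) blast

text \<open>The coordinates in \<open>J\<close> map \<open>W\<close> continuously and injectively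
  into a countable power of the complex plane, where every subset is separable. By compactness of
  \<open>W\<close>, a dense sequence of the image pulls back to a weakly dense one.\<close>

lemma weakly_compact_separable:
  assumes W: "compactin (weak_top_fs V N) W" and J: "countable J" "J \<subseteq> I"
    and sep: "\<And>f g. \<lbrakk>f \<in> V; g \<in> V; \<And>i. i \<in> J \<Longrightarrow> s i f = s i g\<rbrakk> \<Longrightarrow> f = g"
  obtains D where "countable D" "D \<subseteq> W" "W \<subseteq> weak_top_fs V N closure_of D"
proof (cases "J = {}")
  \<comment> \<open>With no coordinates at all, \<open>sep\<close> forces \<open>V\<close> to be
    trivial. This case is split off because the enumeration of \<open>J\<close> needs a nonempty
    set.\<close>
  case True
  then have "f = 0" if "f \<in> V" for f
    using sep[OF that zero_mem] by blast
  then have "W \<subseteq> {0}"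
    using compactin_subset_topspace[OF W] by auto
  then have "countable W"
    by (rule countable_subset) simp
  with that[of W] show ?thesis
    using compactin_subset_topspace[OF W] closure_of_subset by blast
next
  case False
  let ?R = "\<lambda>f (n::nat). s (from_nat_into J n) f"
  have J_I: "from_nat_into J n \<in> I" for n
    using J(2) from_nat_into[OF False] by blast
  have R: "continuous_map (weak_top_fs V N) euclidean ?R"
  proof -
    have "continuous_map (weak_top_fs V N) (product_topology (\<lambda>_. euclidean) UNIV) ?R"
      unfolding continuous_map_componentwise_UNIV
      by (intro allI continuous_map_weak_top_dual s_in_dual J_I)
    then show ?thesis
      by (simp only: euclidean_product_topology)
  qed
  have W_V: "W \<subseteq> V"
    using compactin_subset_topspace[OF W] by simp
  have inj: "inj_on ?R W"
  proof (rule inj_onI)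
    fix f g assume fg: "f \<in> W" "g \<in> W" "?R f = ?R g"
    show "f = g"
    proof (rule sep)
      fix i assume "i \<in> J"
      then obtain n where "i = from_nat_into J n"
        using from_nat_into_surj[OF J(1)] by metis
      then show "s i f = s i g"
        using fun_cong[OF fg(3), of n] by simp
    qed (use fg W_V in auto)
  qed
  obtain D' where D': "countable D'" "D' \<subseteq> ?R ` W" "?R ` W \<subseteq> closure D'"
    using separable by blast
  then obtain D where D: "countable D" "D \<subseteq> W" "D' = ?R ` D"
    using countable_subset_image[of D' ?R W] by auto
  have "W \<subseteq> weak_top_fs V N closure_of D"
    using weak_closure_of_compactin[OF W D(2) _ R inj] D' D by blast
  with D show ?thesis
    using that by blast
qed

end

subsection \<open>Transfer between the two variables of a kernel\<close>

lemma finite_net_of_bounded_functions: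
  fixes h :: "'i \<Rightarrow> 'k \<Rightarrow> complex"
  assumes "finite F" and bound: "\<And>i k. \<lbrakk>i \<in> I; k \<in> F\<rbrakk> \<Longrightarrow> cmod (h i k) \<le> B k" and "e > 0"
  obtains J where "finite J" "J \<subseteq> I" "\<And>i. i \<in> I \<Longrightarrow> \<exists>j\<in>J. \<forall>k\<in>F. cmod (h i k - h j k) < e"
proof -
  \<comment> \<open>Rounding to a grid of mesh \<open>e/2\<close>: two values in one cell differ by
    less than \<open>e/2\<close> in the real and in the imaginary part, hence by less than
    \<open>e\<close>. Boundedness leaves finitely many cells, and one index is kept for each
    occupied pattern.\<close>
  define q where "q i = (\<lambda>k\<in>F. (\<lfloor>Re (h i k) * (2/e)\<rfloor>, \<lfloor>Im (h i k) * (2/e)\<rfloor>))" for i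
  let ?Z = "\<lambda>k. {- \<lceil>B k * (2/e)\<rceil> .. \<lceil>B k * (2/e)\<rceil>}"
  have floor_bound: "\<lfloor>x * (2/e)\<rfloor> \<in> ?Z k" if "\<bar>x\<bar> \<le> B k" for x k
  proof -
    have "x * (2/e) \<le> B k * (2/e)" "- (B k * (2/e)) \<le> x * (2/e)"
      using mult_right_mono[of x "B k" "2/e"] mult_right_mono[of "- B k" x "2/e"] that \<open>e > 0\<close> by (auto simp: abs_le_iff)
    then show ?thesis
      by (simp add: floor_le_iff le_floor_iff) linarith
  qed
  have "q ` I \<subseteq> PiE F (\<lambda>k. ?Z k \<times> ?Z k)"
  proof clarify
    fix i assume "i \<in> I"
    have "\<bar>Re (h i k)\<bar> \<le> B k" "\<bar>Im (h i k)\<bar> \<le> B k" if "k \<in> F" for k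
      using bound[OF \<open>i \<in> I\<close> that] abs_Re_le_cmod[of "h i k"] abs_Im_le_cmod[of "h i k"] by linarith+
    then show "q i \<in> PiE F (\<lambda>k. ?Z k \<times> ?Z k)"
      unfolding q_def by (intro restrict_PiE_iff[THEN iffD2] ballI SigmaI floor_bound)
  qed
  then have "finite (q ` I)"
    by (rule finite_subset) (intro finite_PiE \<open>finite F\<close> finite_cartesian_product; simp)
  then obtain J where J: "finite J" "J \<subseteq> I" "q ` I = q ` J"
    using finite_subset_image[of "q ` I" q I] by auto
  have "\<exists>j\<in>J. \<forall>k\<in>F. cmod (h i k - h j k) < e" if "i \<in> I" for i
  proof -
    obtain j where "j \<in> J" and eq: "q i = q j"
      using J(3) \<open>i \<in> I\<close> by blast
    have "cmod (h i k - h j k) < e" if "k \<in> F" for k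
    proof -
      have close: "\<bar>x - y\<bar> < e/2" if "\<lfloor>x * (2/e)\<rfloor> = \<lfloor>y * (2/e)\<rfloor>" for x y
      proof -
        have "\<bar>x * (2/e) - y * (2/e)\<bar> < 1"
          using that by linarith
        moreover have "\<bar>x * (2/e) - y * (2/e)\<bar> = \<bar>x - y\<bar> * (2/e)"
          unfolding left_diff_distrib[symmetric] abs_mult using \<open>e > 0\<close> by simp
        ultimately have "\<bar>x - y\<bar> * (2/e) < 1"
          by linarith
        then show ?thesis
          using \<open>e > 0\<close> by (simp add: field_simps)
      qed
      have "cmod (h i k - h j k) \<le> \<bar>Re (h i k - h j k)\<bar> + \<bar>Im (h i k - h j k)\<bar>"
        by (rule cmod_le)
      also have "\<dots> < e/2 + e/2"
        using fun_cong[OF eq, of k] \<open>k \<in> F\<close> close by (intro add_strict_mono) (auto simp: q_def)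
      finally show ?thesis by simp
    qed
    with \<open>j \<in> J\<close> show ?thesis by blast
  qed
  with J show ?thesis
    using that by blast
qed

lemma closure_image_continuous:
  assumes "continuous_on UNIV f" and "x \<in> closure S"
  shows "f x \<in> closure (f ` S)"
  using image_closure_subset[OF continuous_on_subset[OF assms(1) subset_UNIV] closed_closure closure_subset] assms(2)
  by blast

text \<open>The points of \<open>Q\<close> where \<open>h\<close> is far from \<open>h q\<close>
  form a compact set. Its image under \<epsilon> is closed and, as \<open>h\<close> is constant on
  the fibre of \<open>q\<close>, misses \<open>\<epsilon> q\<close>; so the sequence eventually
  avoids it.\<close>

lemma compact_image_factor_tendsto:
  fixes \<epsilon> :: "'q::topological_space \<Rightarrow> 'm::metric_space" and h :: "'q \<Rightarrow> complex"
  assumes "compact Q" "continuous_on Q \<epsilon>" "continuous_on Q h" "q \<in> Q" "\<And>n. x n \<in> Q"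
    and lim: "(\<lambda>n. \<epsilon> (x n)) \<longlonglongrightarrow> \<epsilon> q"
    and fibre: "\<And>q'. \<lbrakk>q' \<in> Q; \<epsilon> q' = \<epsilon> q\<rbrakk> \<Longrightarrow> h q' = h q"
  shows "(\<lambda>n. h (x n)) \<longlonglongrightarrow> h q"
proof (rule tendstoI)
  fix e :: real assume "e > 0"
  let ?Z = "Q \<inter> {q'. e \<le> dist (h q') (h q)}"
  have "compact ?Z"
  proof -
    have "continuous_on Q (\<lambda>q'. dist (h q') (h q))"
      by (intro continuous_on_dist continuous_on_const assms(3))
    then obtain U where U: "open U" "U \<inter> Q = (\<lambda>q'. dist (h q') (h q)) -` {..<e} \<inter> Q"
      unfolding continuous_on_open_invariant using open_lessThan by blast
    have "x \<in> ?Z \<longleftrightarrow> x \<in> Q \<inter> (- U)" for x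
      using eqset_imp_iff[OF U(2), of x] by auto
    then have "?Z = Q \<inter> (- U)"
      by blast
    then show ?thesis
      using compact_Int_closed[OF \<open>compact Q\<close>, of "- U"] U(1) by auto
  qed
  then have "closed (\<epsilon> ` ?Z)"
    using assms(2) by (intro compact_imp_closed compact_continuous_image) (auto intro: continuous_on_subset)
  moreover have "\<epsilon> q \<notin> \<epsilon> ` ?Z"
    using fibre \<open>e > 0\<close> by fastforce
  ultimately have "\<forall>\<^sub>F n in sequentially. \<epsilon> (x n) \<in> - (\<epsilon> ` ?Z)"
    using lim by (auto simp: tendsto_def)
  then show "\<forall>\<^sub>F n in sequentially. dist (h (x n)) (h q) < e"
    using assms(5) by (auto elim!: eventually_mono simp: not_le[symmetric])
qed

text \<open>Two families of vectors that carry one and the same kernel, once as coordinates in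
  \<open>V\<^sub>1\<close> and once in \<open>V\<^sub>2\<close>. The set-up is symmetric, so each
  transfer is proved in one direction and reused after a swap. In the application \<open>I\<close>
  indexes the evaluations, \<open>K\<close> is the unit ball of \<open>X\<close>,
  \<open>a\<^sub>1\<close> is \<open>T\<close>, and \<open>a\<^sub>2\<close> gives the adjoint
  functionals.\<close>

locale norming_pair =
  E1: norming_family V\<^sub>1 N\<^sub>1 I s\<^sub>1 C\<^sub>1 + E2: norming_family V\<^sub>2 N\<^sub>2 K s\<^sub>2 C\<^sub>2
  for V\<^sub>1 :: "('a \<Rightarrow> complex) set" and N\<^sub>1 and I :: "'i set" and s\<^sub>1 and C\<^sub>1
    and V\<^sub>2 :: "('b \<Rightarrow> complex) set" and N\<^sub>2 and K :: "'k set" and s\<^sub>2 and C\<^sub>2 +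
  fixes a\<^sub>1 :: "'k \<Rightarrow> 'a \<Rightarrow> complex" and a\<^sub>2 :: "'i \<Rightarrow> 'b \<Rightarrow> complex" and B :: real
  assumes a1_mem: "k \<in> K \<Longrightarrow> a\<^sub>1 k \<in> V\<^sub>1" and a2_mem: "i \<in> I \<Longrightarrow> a\<^sub>2 i \<in> V\<^sub>2"
    and a1_bound: "k \<in> K \<Longrightarrow> N\<^sub>1 (a\<^sub>1 k) \<le> B" and a2_bound: "i \<in> I \<Longrightarrow> N\<^sub>2 (a\<^sub>2 i) \<le> B"
    and pairing: "\<lbrakk>i \<in> I; k \<in> K\<rbrakk> \<Longrightarrow> s\<^sub>1 i (a\<^sub>1 k) = s\<^sub>2 k (a\<^sub>2 i)"
begin

text \<open>A finite net for the vectors \<open>a\<^sub>1 k\<close> reduces the kernel to finitely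
  many columns; there the rows form a bounded set in finite dimension, which has a finite net of its
  own.\<close>

lemma rel_compact_transfer:
  assumes "rel_compact_in (norm_top_fs V\<^sub>1 N\<^sub>1) (a\<^sub>1 ` K)"
  shows "rel_compact_in (norm_top_fs V\<^sub>2 N\<^sub>2) (a\<^sub>2 ` I)"
proof (subst E2.rel_compact_norm_top_iff)
  show "a\<^sub>2 ` I \<subseteq> V\<^sub>2"
    using a2_mem by blast
  show "\<forall>e>0. \<exists>F. finite F \<and> F \<subseteq> a\<^sub>2 ` I \<and> (\<forall>f\<in>a\<^sub>2 ` I. \<exists>g\<in>F. N\<^sub>2 (f - g) < e)"
  proof (intro allI impI)
    fix e' :: real assume "e' > 0"
    \<comment> \<open>Three errors of size \<open>e\<close> add up, and \<open>norm_le\<close> costs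
      the factor \<open>C\<^sub>2\<close>; this leaves three quarters of \<open>e'\<close>.\<close>
    define e where "e = e' / (4 * C\<^sub>2)"
    have "e > 0" and e: "C\<^sub>2 * (3 * e) < e'"
      using \<open>e' > 0\<close> E2.const_pos by (simp_all add: e_def)
    have "a\<^sub>1 ` K \<subseteq> V\<^sub>1"
      using a1_mem by blast
    then obtain F' where "finite F'" "F' \<subseteq> a\<^sub>1 ` K" and F': "\<And>f. f \<in> a\<^sub>1 ` K \<Longrightarrow> \<exists>g\<in>F'. N\<^sub>1 (f - g) < e"
      using assms \<open>e > 0\<close> E1.rel_compact_norm_top_iff by meson
    then obtain F where F: "finite F" "F \<subseteq> K" "F' = a\<^sub>1 ` F"
      by (meson finite_subset_image)
    have "cmod (s\<^sub>1 i (a\<^sub>1 k)) \<le> N\<^sub>1 (a\<^sub>1 k)" if "i \<in> I" "k \<in> F" for i k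
      using that F(2) a1_mem E1.s_le_norm by blast
    then obtain J where J: "finite J" "J \<subseteq> I"
      and net: "\<And>i. i \<in> I \<Longrightarrow> \<exists>j\<in>J. \<forall>k\<in>F. cmod (s\<^sub>1 i (a\<^sub>1 k) - s\<^sub>1 j (a\<^sub>1 k)) < e"
      using finite_net_of_bounded_functions[OF F(1), of I "\<lambda>i k. s\<^sub>1 i (a\<^sub>1 k)" "\<lambda>k. N\<^sub>1 (a\<^sub>1 k)", OF _ \<open>e > 0\<close>]
      by metis
    have "\<exists>j\<in>J. N\<^sub>2 (a\<^sub>2 i - a\<^sub>2 j) < e'" if i: "i \<in> I" for i
    proof -
      obtain j where "j \<in> J" and j: "\<And>k. k \<in> F \<Longrightarrow> cmod (s\<^sub>1 i (a\<^sub>1 k) - s\<^sub>1 j (a\<^sub>1 k)) < e"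
        using net[OF i] by blast
      then have "j \<in> I"
        using J by blast
      have "cmod (s\<^sub>2 k (a\<^sub>2 i - a\<^sub>2 j)) \<le> 3 * e" if k: "k \<in> K" for k
      proof -
        obtain l where "l \<in> F" and l: "N\<^sub>1 (a\<^sub>1 k - a\<^sub>1 l) < e"
          using F'[of "a\<^sub>1 k"] k F(3) by blast
        then have "l \<in> K"
          using F(2) by blast
        have near: "cmod (s\<^sub>1 i' (a\<^sub>1 k) - s\<^sub>1 i' (a\<^sub>1 l)) < e" if "i' \<in> I" for i'
          using E1.s_le_norm[OF that E1.diff_mem[OF a1_mem[OF k] a1_mem[OF \<open>l \<in> K\<close>]]] l
          by (simp add: E1.s_diff[OF that a1_mem[OF k] a1_mem[OF \<open>l \<in> K\<close>]])
        have "s\<^sub>2 k (a\<^sub>2 i - a\<^sub>2 j) = s\<^sub>1 i (a\<^sub>1 k) - s\<^sub>1 j (a\<^sub>1 k)"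
          using i \<open>j \<in> I\<close> k by (simp add: E2.s_diff a2_mem pairing)
        also have "\<dots> = (s\<^sub>1 i (a\<^sub>1 k) - s\<^sub>1 i (a\<^sub>1 l)) + (s\<^sub>1 i (a\<^sub>1 l) - s\<^sub>1 j (a\<^sub>1 l))
            - (s\<^sub>1 j (a\<^sub>1 k) - s\<^sub>1 j (a\<^sub>1 l))"
          by simp
        finally have eq: "s\<^sub>2 k (a\<^sub>2 i - a\<^sub>2 j) = \<dots>" .
        show ?thesis
          unfolding eq using near[OF i] near[OF \<open>j \<in> I\<close>] j[OF \<open>l \<in> F\<close>]
            norm_triangle_ineq4[of "(s\<^sub>1 i (a\<^sub>1 k) - s\<^sub>1 i (a\<^sub>1 l)) + (s\<^sub>1 i (a\<^sub>1 l) - s\<^sub>1 j (a\<^sub>1 l))" "s\<^sub>1 j (a\<^sub>1 k) - s\<^sub>1 j (a\<^sub>1 l)"]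
            norm_triangle_ineq[of "s\<^sub>1 i (a\<^sub>1 k) - s\<^sub>1 i (a\<^sub>1 l)" "s\<^sub>1 i (a\<^sub>1 l) - s\<^sub>1 j (a\<^sub>1 l)"]
          by linarith
      qed
      then have "N\<^sub>2 (a\<^sub>2 i - a\<^sub>2 j) \<le> C\<^sub>2 * (3 * e)"
        using i \<open>j \<in> I\<close> a2_mem by (intro E2.norm_le E2.diff_mem) auto
      then show ?thesis
        using e \<open>j \<in> J\<close> by (intro bexI[of _ j]) auto
    qed
    then show "\<exists>F. finite F \<and> F \<subseteq> a\<^sub>2 ` I \<and> (\<forall>f\<in>a\<^sub>2 ` I. \<exists>g\<in>F. N\<^sub>2 (f - g) < e')"
      using J by (intro exI[of _ "a\<^sub>2 ` J"]) auto
  qed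
qed

text \<open>The assignment of \<open>a\<^sub>2 i\<close> to \<open>s\<^sub>1 i\<close> is extended
  to a map \<eta> on the compact closure \<open>?Q\<close>. It factors through \<epsilon>, the
  evaluation at the countable set \<open>D\<close>, and the induced map \<theta> is weakly
  continuous on the compact metrizable image of \<epsilon>. The image of \<theta> is the weakly
  compact set that contains all \<open>a\<^sub>2 i\<close>.\<close>

lemma rel_weakly_compact_transfer:
  assumes W: "compactin (weak_top_fs V\<^sub>1 N\<^sub>1) W" and a1_W: "a\<^sub>1 ` K \<subseteq> W"
    and D: "countable D" "D \<subseteq> V\<^sub>1" "W \<subseteq> weak_top_fs V\<^sub>1 N\<^sub>1 closure_of D"
  shows "rel_compact_in (weak_top_fs V\<^sub>2 N\<^sub>2) (a\<^sub>2 ` I)"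
proof -
  let ?Q = "E1.weak_star_closure" and ?\<Gamma> = "E2.weak_star_closure"
  have W_V: "W \<subseteq> V\<^sub>1"
    using compactin_subset_topspace[OF W] by simp
  \<comment> \<open>The coordinates prescribed by \<psi> are pointwise limits of those of the
    vectors \<open>a\<^sub>2 i\<close>, all of norm at most \<open>B\<close>, so
    \<open>pointwise_closed\<close> applies.\<close>
  have "\<exists>f\<in>V\<^sub>2. \<forall>k\<in>K. s\<^sub>2 k f = \<psi> (a\<^sub>1 k)" if \<psi>: "\<psi> \<in> ?Q" for \<psi>
  proof -
    let ?r = "\<lambda>\<phi> k. if k \<in> K then \<phi> (a\<^sub>1 k) else (0::complex)"
    have "continuous_on UNIV ?r"
    proof (rule continuous_on_coordinatewise_then_product)
      fix k
      show "continuous_on UNIV (\<lambda>\<phi>. ?r \<phi> k)"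
        by (cases "k \<in> K") (simp_all add: continuous_on_eval)
    qed
    then have "?r \<psi> \<in> closure (?r ` (s\<^sub>1 ` I))"
      using \<psi> unfolding E1.weak_star_closure_def by (rule closure_image_continuous)
    moreover have "?r ` (s\<^sub>1 ` I) \<subseteq> (\<lambda>f k. if k \<in> K then s\<^sub>2 k f else 0) ` {f \<in> V\<^sub>2. N\<^sub>2 f \<le> B}"
    proof clarify
      fix i assume "i \<in> I"
      then have "?r (s\<^sub>1 i) = (\<lambda>f k. if k \<in> K then s\<^sub>2 k f else 0) (a\<^sub>2 i)"
        by (auto simp: fun_eq_iff pairing)
      with \<open>i \<in> I\<close> show "?r (s\<^sub>1 i) \<in> (\<lambda>f k. if k \<in> K then s\<^sub>2 k f else 0) ` {f \<in> V\<^sub>2. N\<^sub>2 f \<le> B}"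
        using a2_mem a2_bound by blast
    qed
    ultimately have "?r \<psi> \<in> closure ((\<lambda>f k. if k \<in> K then s\<^sub>2 k f else 0) ` {f \<in> V\<^sub>2. N\<^sub>2 f \<le> B})"
      using closure_mono by blast
    then show ?thesis
      using E2.pointwise_closed by fastforce
  qed
  then obtain \<eta> where \<eta>: "\<And>\<psi>. \<psi> \<in> ?Q \<Longrightarrow> \<eta> \<psi> \<in> V\<^sub>2"
    and s_\<eta>: "\<And>\<psi> k. \<lbrakk>\<psi> \<in> ?Q; k \<in> K\<rbrakk> \<Longrightarrow> s\<^sub>2 k (\<eta> \<psi>) = \<psi> (a\<^sub>1 k)"
    by metis
  have \<eta>_bound: "N\<^sub>2 (\<eta> \<psi>) \<le> C\<^sub>2 * B" if "\<psi> \<in> ?Q" for \<psi>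
  proof (rule E2.norm_le[OF \<eta>[OF that]])
    fix k assume "k \<in> K"
    then show "cmod (s\<^sub>2 k (\<eta> \<psi>)) \<le> B"
      using E1.closure_le_norm[OF that a1_mem] a1_bound s_\<eta>[OF that] by fastforce
  qed
  have \<eta>_s: "\<eta> (s\<^sub>1 i) = a\<^sub>2 i" if "i \<in> I" for i
    using that E1.s_in_closure by (intro E2.s_separates) (auto simp: \<eta> a2_mem s_\<eta> pairing)
  text \<open>By weak compactness of \<open>W\<close>, every \<open>\<gamma>\<close> acts on \<open>\<eta> ` Q\<close> as evaluation at a point of \<open>W\<close>.\<close>
  have \<gamma>_eval: "\<exists>y\<in>W. \<forall>\<psi>\<in>?Q. \<gamma> (\<eta> \<psi>) = \<psi> y" if \<gamma>: "\<gamma> \<in> ?\<Gamma>" for \<gamma>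
  proof -
    let ?R = "\<lambda>y \<psi>. if \<psi> \<in> ?Q then \<psi> y else (0::complex)"
    let ?t = "\<lambda>\<phi> \<psi>. if \<psi> \<in> ?Q then \<phi> (\<eta> \<psi>) else (0::complex)"
    have "continuous_map (weak_top_fs V\<^sub>1 N\<^sub>1) (product_topology (\<lambda>_. euclidean) UNIV) ?R"
      unfolding continuous_map_componentwise_UNIV
    proof
      fix \<psi>
      show "continuous_map (weak_top_fs V\<^sub>1 N\<^sub>1) euclidean (\<lambda>y. ?R y \<psi>)"
        using continuous_map_weak_top_dual[OF E1.closure_in_dual] by (cases "\<psi> \<in> ?Q") auto
    qed
    then have "continuous_map (weak_top_fs V\<^sub>1 N\<^sub>1) euclidean ?R"
      by (simp only: euclidean_product_topology)
    from image_compactin[OF W this] have "compact (?R ` W)"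
      by simp
    then have "closed (?R ` W)"
      by (rule compact_imp_closed_fun)
    moreover have "continuous_on UNIV ?t"
    proof (rule continuous_on_coordinatewise_then_product)
      fix \<psi>
      show "continuous_on UNIV (\<lambda>\<phi>. ?t \<phi> \<psi>)"
        by (cases "\<psi> \<in> ?Q") (simp_all add: continuous_on_eval)
    qed
    \<comment> \<open>For the functional \<open>s\<^sub>2 k\<close> the required point of
      \<open>W\<close> is \<open>a\<^sub>1 k\<close>. The set of evaluations at points of
      \<open>W\<close> is compact, hence closed, so the property extends to pointwise
      limits.\<close>
    moreover have "?t ` (s\<^sub>2 ` K) \<subseteq> ?R ` W"
    proof clarify
      fix k assume "k \<in> K"
      then have "?t (s\<^sub>2 k) = ?R (a\<^sub>1 k)"
        by (auto simp: fun_eq_iff s_\<eta>)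
      with \<open>k \<in> K\<close> show "?t (s\<^sub>2 k) \<in> ?R ` W"
        using a1_W by blast
    qed
    ultimately have "?t ` closure (s\<^sub>2 ` K) \<subseteq> ?R ` W"
      by (intro image_closure_subset) (auto intro: continuous_on_subset)
    then have "?t \<gamma> \<in> ?R ` W"
      using \<gamma> unfolding E2.weak_star_closure_def by blast
    then obtain y where y: "y \<in> W" "?t \<gamma> = ?R y"
      by blast
    have "\<gamma> (\<eta> \<psi>) = \<psi> y" if "\<psi> \<in> ?Q" for \<psi>
      using fun_cong[OF y(2), of \<psi>] that by simp
    with y(1) show ?thesis
      by blast
  qed
  \<comment> \<open>The harmless point 0 guarantees that there is something to enumerate.\<close>
  define d where "d = from_nat_into (insert 0 D)"
  have d: "range d = insert 0 D"
    unfolding d_def using D(1) by (intro range_from_nat_into) auto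
  define \<epsilon> where "\<epsilon> \<psi> = (\<lambda>n. \<psi> (d n))" for \<psi> :: "('a \<Rightarrow> complex) \<Rightarrow> complex"
  have \<epsilon>_cont: "continuous_on S \<epsilon>" for S
    unfolding \<epsilon>_def by (intro continuous_on_coordinatewise_then_product continuous_on_eval)
  \<comment> \<open>The difference of two elements of \<open>?Q\<close> is weakly continuous on
    \<open>V\<^sub>1\<close>, so if it vanishes on \<open>D\<close> it vanishes on the weak closure
    of \<open>D\<close>, which contains \<open>W\<close>.\<close>
  have \<epsilon>_eq: "\<psi> y = \<psi>' y" if "\<psi> \<in> ?Q" "\<psi>' \<in> ?Q" "\<epsilon> \<psi> = \<epsilon> \<psi>'" "y \<in> W" for \<psi> \<psi>' y
  proof (rule ccontr)
    assume "\<psi> y \<noteq> \<psi>' y"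
    have cont: "continuous_map (weak_top_fs V\<^sub>1 N\<^sub>1) euclidean (\<lambda>f. \<psi> f - \<psi>' f)"
      using that by (intro continuous_map_diff continuous_map_weak_top_dual E1.closure_in_dual)
    let ?O = "{f \<in> V\<^sub>1. \<psi> f - \<psi>' f \<in> - {0}}"
    have "openin (weak_top_fs V\<^sub>1 N\<^sub>1) ?O"
      using openin_continuous_map_preimage[OF cont, of "- {0}"] by (simp add: open_Compl)
    moreover have "y \<in> ?O"
      using that W_V \<open>\<psi> y \<noteq> \<psi>' y\<close> by auto
    moreover have "\<forall>U. y \<in> U \<and> openin (weak_top_fs V\<^sub>1 N\<^sub>1) U \<longrightarrow> (\<exists>f. f \<in> D \<and> f \<in> U)"
      using subsetD[OF D(3) \<open>y \<in> W\<close>] unfolding in_closure_of by (rule conjunct2)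
    ultimately have "\<exists>f. f \<in> D \<and> f \<in> ?O"
      by (metis (no_types, lifting))
    then obtain f where "f \<in> D" "\<psi> f \<noteq> \<psi>' f"
      by auto
    then obtain n where "f = d n"
      using d by (metis insertI2 rangeE)
    with \<open>\<psi> f \<noteq> \<psi>' f\<close> show False
      using fun_cong[OF that(3), of n] by (simp add: \<epsilon>_def)
  qed
  have \<epsilon>_\<eta>: "\<eta> \<psi> = \<eta> \<psi>'" if "\<psi> \<in> ?Q" "\<psi>' \<in> ?Q" "\<epsilon> \<psi> = \<epsilon> \<psi>'" for \<psi> \<psi>'
  proof (rule E2.s_separates[OF \<eta>[OF that(1)] \<eta>[OF that(2)]])
    fix k assume "k \<in> K"
    then show "s\<^sub>2 k (\<eta> \<psi>) = s\<^sub>2 k (\<eta> \<psi>')"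
      using \<epsilon>_eq[OF that, of "a\<^sub>1 k"] a1_W that by (auto simp: s_\<eta>)
  qed
  \<comment> \<open>The chosen representative does not matter: by \<open>\<epsilon>_\<eta>\<close>,
    the map \<eta> is constant on the fibres of \<epsilon>.\<close>
  define \<theta> where "\<theta> x = \<eta> (inv_into ?Q \<epsilon> x)" for x
  have \<theta>: "\<theta> (\<epsilon> \<psi>) = \<eta> \<psi>" if "\<psi> \<in> ?Q" for \<psi>
    unfolding \<theta>_def using that by (intro \<epsilon>_\<eta>) (auto simp: inv_into_into f_inv_into_f)
  let ?L = "\<epsilon> ` ?Q"
  have "compact ?L"
    using E1.compact_weak_star_closure \<epsilon>_cont by (intro compact_continuous_image)
  have "continuous_map (top_of_set ?L) (weak_top_fs V\<^sub>2 N\<^sub>2) \<theta>"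
  proof (rule continuous_map_into_weak_top)
    show "\<theta> ` topspace (top_of_set ?L) \<subseteq> V\<^sub>2"
      using \<theta> \<eta> by auto
    fix \<Psi> assume \<Psi>: "\<Psi> \<in> dual_fs V\<^sub>2 N\<^sub>2"
    have "continuous_on ?L (\<lambda>x. \<Psi> (\<theta> x))"
      unfolding continuous_on_sequentially
    proof (intro allI ballI impI)
      fix x l assume l: "l \<in> ?L" and x: "(\<forall>n. x n \<in> ?L) \<and> x \<longlonglongrightarrow> l"
      obtain \<psi> where \<psi>: "\<psi> \<in> ?Q" "l = \<epsilon> \<psi>"
        using l by blast
      have "\<forall>n. \<exists>\<phi>. \<phi> \<in> ?Q \<and> x n = \<epsilon> \<phi>"
        using x by blast
      then obtain \<phi> where \<phi>: "\<And>n. \<phi> n \<in> ?Q" "\<And>n. x n = \<epsilon> (\<phi> n)"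
        by metis
      then have "x = (\<lambda>n. \<epsilon> (\<phi> n))"
        by blast
      with x \<psi>(2) have lim: "(\<lambda>n. \<epsilon> (\<phi> n)) \<longlonglongrightarrow> \<epsilon> \<psi>"
        by simp
      have "(\<lambda>n. \<Psi> (\<eta> (\<phi> n) - \<eta> \<psi>)) \<longlonglongrightarrow> 0"
      proof (rule E2.weakly_null_if_null_on_closure[OF \<Psi>])
        show "\<eta> (\<phi> n) - \<eta> \<psi> \<in> V\<^sub>2" for n
          by (intro E2.diff_mem \<eta> \<phi> \<psi>)
        show "N\<^sub>2 (\<eta> (\<phi> n) - \<eta> \<psi>) \<le> C\<^sub>2 * B + C\<^sub>2 * B" for n
          using E2.norm_diff_triangle[OF \<eta>[OF \<phi>(1)] E2.zero_mem \<eta>[OF \<psi>(1)], of n]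
            E2.norm_minus_commute[OF \<eta>[OF \<psi>(1)] E2.zero_mem] \<eta>_bound[OF \<phi>(1), of n] \<eta>_bound[OF \<psi>(1)]
          by (simp add: mult.commute)
        \<comment> \<open>On values of \<eta>, \<gamma> is evaluation at some \<open>y\<close> in
          \<open>W\<close>. Evaluation at \<open>y\<close> is constant on the fibres of \<epsilon>,
          so it follows the convergence of the images under \<epsilon>; this is the hypothesis of
          the weak-null criterion.\<close>
        fix \<gamma> assume \<gamma>: "\<gamma> \<in> ?\<Gamma>"
        then obtain y where y: "y \<in> W" "\<And>\<psi>. \<psi> \<in> ?Q \<Longrightarrow> \<gamma> (\<eta> \<psi>) = \<psi> y"
          using \<gamma>_eval by blast
        have "(\<lambda>n. \<phi> n y) \<longlonglongrightarrow> \<psi> y"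
        proof (rule compact_image_factor_tendsto[where Q = ?Q and \<epsilon> = \<epsilon> and h = "\<lambda>\<psi>. \<psi> y" and q = \<psi> and x = \<phi>])
          show "\<psi>' y = \<psi> y" if "\<psi>' \<in> ?Q" "\<epsilon> \<psi>' = \<epsilon> \<psi>" for \<psi>'
            using \<epsilon>_eq[OF that(1) \<psi>(1) that(2) y(1)] .
        qed (fact E1.compact_weak_star_closure \<epsilon>_cont continuous_on_eval \<psi>(1) \<phi>(1) lim)+
        then show "(\<lambda>n. \<gamma> (\<eta> (\<phi> n) - \<eta> \<psi>)) \<longlonglongrightarrow> 0"
          by (simp add: E2.closure_diff[OF \<gamma> \<eta> \<eta>] \<phi> \<psi> y LIM_zero)
      qed
      then have "(\<lambda>n. \<Psi> (\<eta> (\<phi> n)) - \<Psi> (\<eta> \<psi>)) \<longlonglongrightarrow> 0"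
        by (simp add: E2.dual_diff[OF \<Psi> \<eta> \<eta>] \<phi> \<psi>)
      then show "((\<lambda>x. \<Psi> (\<theta> x)) \<circ> x) \<longlonglongrightarrow> \<Psi> (\<theta> l)"
        by (simp add: o_def \<phi> \<psi> \<theta> LIM_zero_iff)
    qed
    then show "continuous_map (top_of_set ?L) euclidean (\<lambda>x. \<Psi> (\<theta> x))"
      by simp
  qed
  then have "compactin (weak_top_fs V\<^sub>2 N\<^sub>2) (\<theta> ` ?L)"
    using \<open>compact ?L\<close> by (intro image_compactin[of "top_of_set ?L"]) (simp_all add: compactin_subtopology)
  moreover have "a\<^sub>2 ` I \<subseteq> \<theta> ` ?L"
  proof clarify
    fix i assume "i \<in> I"
    then have "a\<^sub>2 i = \<theta> (\<epsilon> (s\<^sub>1 i))"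
      using \<theta>[OF E1.s_in_closure] \<eta>_s by simp
    with \<open>i \<in> I\<close> show "a\<^sub>2 i \<in> \<theta> ` ?L"
      using E1.s_in_closure by blast
  qed
  ultimately show ?thesis
    by (rule rel_compact_in_subset_compactin[OF E2.Hausdorff_weak_top])
qed

text \<open>Density of the functionals gives density of the vectors only in the topology of the
  coordinates in \<open>K\<close>. Inside a weakly compact set that topology already yields the weak
  closure.\<close>

lemma weakly_dense_if_index_dense:
  assumes W: "compactin (weak_top_fs V\<^sub>2 N\<^sub>2) W" and "a\<^sub>2 ` I \<subseteq> W" and "J \<subseteq> I"
    and dense: "\<And>i. i \<in> I \<Longrightarrow> s\<^sub>1 i \<in> closure (s\<^sub>1 ` J)"
  shows "a\<^sub>2 ` I \<subseteq> weak_top_fs V\<^sub>2 N\<^sub>2 closure_of (a\<^sub>2 ` J)"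
proof clarify
  fix i assume "i \<in> I"
  let ?R = "\<lambda>f k. if k \<in> K then s\<^sub>2 k f else 0"
  let ?r = "\<lambda>\<phi> k. if k \<in> K then \<phi> (a\<^sub>1 k) else (0::complex)"
  have W_V: "W \<subseteq> V\<^sub>2"
    using compactin_subset_topspace[OF W] by simp
  have R_a: "?R (a\<^sub>2 j) = ?r (s\<^sub>1 j)" if "j \<in> I" for j
    using that by (auto simp: fun_eq_iff pairing)
  have "continuous_map (weak_top_fs V\<^sub>2 N\<^sub>2) (product_topology (\<lambda>_. euclidean) UNIV) ?R"
    unfolding continuous_map_componentwise_UNIV
  proof
    fix k
    show "continuous_map (weak_top_fs V\<^sub>2 N\<^sub>2) euclidean (\<lambda>f. ?R f k)"
      using continuous_map_weak_top_dual[OF E2.s_in_dual] by (cases "k \<in> K") auto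
  qed
  then have cont: "continuous_map (weak_top_fs V\<^sub>2 N\<^sub>2) euclidean ?R"
    by (simp only: euclidean_product_topology)
  have inj: "inj_on ?R W"
  proof (rule inj_onI)
    fix f g assume fg: "f \<in> W" "g \<in> W" "?R f = ?R g"
    show "f = g"
    proof (rule E2.s_separates)
      show "s\<^sub>2 k f = s\<^sub>2 k g" if "k \<in> K" for k
        using fun_cong[OF fg(3), of k] that by simp
    qed (use fg W_V in auto)
  qed
  have "continuous_on UNIV ?r"
  proof (rule continuous_on_coordinatewise_then_product)
    fix k
    show "continuous_on UNIV (\<lambda>\<phi>. ?r \<phi> k)"
      by (cases "k \<in> K") (simp_all add: continuous_on_eval)
  qed
  then have "?r (s\<^sub>1 i) \<in> closure (?r ` (s\<^sub>1 ` J))"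
    by (rule closure_image_continuous[OF _ dense[OF \<open>i \<in> I\<close>]])
  moreover have "?r ` (s\<^sub>1 ` J) = ?R ` (a\<^sub>2 ` J)"
    unfolding image_image using R_a \<open>J \<subseteq> I\<close> by (intro image_cong) auto
  ultimately have "?R (a\<^sub>2 i) \<in> closure (?R ` (a\<^sub>2 ` J))"
    using R_a[OF \<open>i \<in> I\<close>] by metis
  then show "a\<^sub>2 i \<in> weak_top_fs V\<^sub>2 N\<^sub>2 closure_of (a\<^sub>2 ` J)"
    using assms(2,3) \<open>i \<in> I\<close> by (intro weak_closure_of_compactin[OF W _ _ cont inj]) auto
qed

lemma norming_pair_swap: "norming_pair V\<^sub>2 N\<^sub>2 K s\<^sub>2 C\<^sub>2 V\<^sub>1 N\<^sub>1 I s\<^sub>1 C\<^sub>1 a\<^sub>2 a\<^sub>1 B"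
  by unfold_locales (use a1_mem a2_mem a1_bound a2_bound pairing in auto)

theorem rel_compact_iff:
  "rel_compact_in (norm_top_fs V\<^sub>1 N\<^sub>1) (a\<^sub>1 ` K) \<longleftrightarrow> rel_compact_in (norm_top_fs V\<^sub>2 N\<^sub>2) (a\<^sub>2 ` I)"
  using rel_compact_transfer norming_pair.rel_compact_transfer[OF norming_pair_swap] by blast

text \<open>The countable dense \<open>J\<close> serves both directions. For a compact set in
  \<open>V\<^sub>1\<close>, the functionals of \<open>J\<close> separate points, which makes the set
  weakly separable; for one in \<open>V\<^sub>2\<close>, the vectors indexed by \<open>J\<close> are
  themselves weakly dense.\<close>

theorem rel_weakly_compact_iff:
  assumes J: "countable J" "J \<subseteq> I" and dense: "\<And>i. i \<in> I \<Longrightarrow> s\<^sub>1 i \<in> closure (s\<^sub>1 ` J)"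
  shows "rel_compact_in (weak_top_fs V\<^sub>1 N\<^sub>1) (a\<^sub>1 ` K) \<longleftrightarrow> rel_compact_in (weak_top_fs V\<^sub>2 N\<^sub>2) (a\<^sub>2 ` I)"
proof
  let ?W = "weak_top_fs V\<^sub>1 N\<^sub>1 closure_of (a\<^sub>1 ` K)"
  assume "rel_compact_in (weak_top_fs V\<^sub>1 N\<^sub>1) (a\<^sub>1 ` K)"
  then have W: "compactin (weak_top_fs V\<^sub>1 N\<^sub>1) ?W"
    by (simp add: rel_compact_in_def)
  have "f = g" if fg: "f \<in> V\<^sub>1" "g \<in> V\<^sub>1" and eq: "\<And>i. i \<in> J \<Longrightarrow> s\<^sub>1 i f = s\<^sub>1 i g" for f g
  proof (rule E1.s_separates[OF fg])
    fix i assume "i \<in> I"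
    have "closed {\<phi> :: ('a \<Rightarrow> complex) \<Rightarrow> complex. \<phi> f = \<phi> g}"
      by (intro closed_Collect_eq continuous_on_eval)
    then have "closure (s\<^sub>1 ` J) \<subseteq> {\<phi>. \<phi> f = \<phi> g}"
      using eq by (intro closure_minimal) auto
    then show "s\<^sub>1 i f = s\<^sub>1 i g"
      using dense[OF \<open>i \<in> I\<close>] by blast
  qed
  then obtain D where D: "countable D" "D \<subseteq> ?W" "?W \<subseteq> weak_top_fs V\<^sub>1 N\<^sub>1 closure_of D"
    using E1.weakly_compact_separable[OF W J] by metis
  show "rel_compact_in (weak_top_fs V\<^sub>2 N\<^sub>2) (a\<^sub>2 ` I)"
  proof (rule rel_weakly_compact_transfer[OF W _ D(1) _ D(3)])
    show "a\<^sub>1 ` K \<subseteq> ?W"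
      using a1_mem by (intro closure_of_subset) auto
    show "D \<subseteq> V\<^sub>1"
      using D(2) closure_of_subset_topspace[of "weak_top_fs V\<^sub>1 N\<^sub>1"] by auto
  qed
next
  let ?W = "weak_top_fs V\<^sub>2 N\<^sub>2 closure_of (a\<^sub>2 ` I)"
  assume "rel_compact_in (weak_top_fs V\<^sub>2 N\<^sub>2) (a\<^sub>2 ` I)"
  then have W: "compactin (weak_top_fs V\<^sub>2 N\<^sub>2) ?W"
    by (simp add: rel_compact_in_def)
  have a2_W: "a\<^sub>2 ` I \<subseteq> ?W"
    using a2_mem by (intro closure_of_subset) auto
  have "a\<^sub>2 ` I \<subseteq> weak_top_fs V\<^sub>2 N\<^sub>2 closure_of (a\<^sub>2 ` J)"
    by (rule weakly_dense_if_index_dense[OF W a2_W J(2) dense])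
  then have "?W \<subseteq> weak_top_fs V\<^sub>2 N\<^sub>2 closure_of (a\<^sub>2 ` J)"
    by (rule closure_of_minimal) simp
  then show "rel_compact_in (weak_top_fs V\<^sub>1 N\<^sub>1) (a\<^sub>1 ` K)"
    using J a2_mem
    by (intro norming_pair.rel_weakly_compact_transfer[OF norming_pair_swap W a2_W, of "a\<^sub>2 ` J"]) auto
qed

end

subsection \<open>The weighted spaces\<close>

lemma Hol_zero: "0 \<in> Hol"
  by (simp add: Hol_def zero_fun_def)

lemma Hol_add: "\<lbrakk>f \<in> Hol; g \<in> Hol\<rbrakk> \<Longrightarrow> f + g \<in> Hol"
  by (auto simp: Hol_def plus_fun_def intro: holomorphic_on_add)

lemma Hol_csmul: "f \<in> Hol \<Longrightarrow> csmul c f \<in> Hol"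
  by (auto simp: Hol_def csmul_def intro!: holomorphic_intros)

lemma Hol_eqI: "\<lbrakk>f \<in> Hol; g \<in> Hol; \<And>z. z \<in> disk \<Longrightarrow> f z = g z\<rbrakk> \<Longrightarrow> f = g"
  by (auto simp: Hol_def fun_eq_iff) (metis dist_0_norm)

lemma Hol_field_differentiable: "\<lbrakk>f \<in> Hol; z \<in> disk\<rbrakk> \<Longrightarrow> f field_differentiable at z"
  by (auto simp: Hol_def intro: holomorphic_on_imp_differentiable_at)

lemma typical_weight_pos: "\<lbrakk>typical_weight v; z \<in> disk\<rbrakk> \<Longrightarrow> 0 < v z"
  by (simp add: typical_weight_def)

lemma Hv_le:
  assumes "f \<in> Hv v" "z \<in> disk"
  shows "v z * cmod (f z) \<le> Hv_norm v f"
  using assms unfolding Hv_norm_def by (intro cSUP_upper) (auto simp: Hv_def)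

lemma Hv_norm_le:
  assumes "\<And>z. z \<in> disk \<Longrightarrow> v z * cmod (f z) \<le> a"
  shows "Hv_norm v f \<le> a"
  unfolding Hv_norm_def by (rule cSUP_least) (use assms in auto)

lemma Hv_I:
  assumes "f \<in> Hol" "\<And>z. z \<in> disk \<Longrightarrow> v z * cmod (f z) \<le> a"
  shows "f \<in> Hv v"
  using assms unfolding Hv_def by (auto intro!: bdd_aboveI2)

text \<open>Membership in the closure gives approximation at finitely many points at a time, while
  Montel's theorem wants a sequence. So \<open>u\<close> is approximated on a countable dense set
  together with one extra point \<open>w\<close>. The limits for different \<open>w\<close> agree on
  the dense set, hence everywhere by continuity, so one holomorphic function serves all
  \<open>w\<close>.\<close>

lemma weighted_ball_pointwise_closed:
  assumes v: "typical_weight v"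
    and u: "u \<in> closure ((\<lambda>f z. if z \<in> disk then complex_of_real (v z) * f z else 0) `
      {f \<in> Hol. \<forall>z\<in>disk. v z * cmod (f z) \<le> B})"
  obtains g where "g \<in> Hol" "\<And>z. z \<in> disk \<Longrightarrow> complex_of_real (v z) * g z = u z"
    "\<And>z. z \<in> disk \<Longrightarrow> v z * cmod (g z) \<le> B"
proof -
  let ?G = "{f \<in> Hol. \<forall>z\<in>disk. v z * cmod (f z) \<le> B}"
  let ?h = "\<lambda>f z. if z \<in> disk then complex_of_real (v z) * f z else 0"
  \<comment> \<open>A continuous positive weight has a positive minimum on a compact set, so the
    weighted bound becomes the uniform bound of Montel's theorem.\<close>
  have locally_bounded: "\<exists>M. \<forall>f\<in>?G. \<forall>z\<in>K. cmod (f z) \<le> M" if K: "compact K" "K \<subseteq> disk" for K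
  proof (cases "K = {}")
    case False
    have "continuous_on K v"
      using v K continuous_on_subset unfolding typical_weight_def by blast
    then obtain x where x: "x \<in> K" "\<And>z. z \<in> K \<Longrightarrow> v x \<le> v z"
      using continuous_attains_inf[OF K(1) False] by blast
    have "v x > 0"
      using x(1) K v typical_weight_pos by blast
    have "cmod (f z) \<le> B / v x" if "f \<in> ?G" "z \<in> K" for f z
    proof -
      have "cmod (f z) * v x \<le> cmod (f z) * v z"
        using x(2)[OF that(2)] by (intro mult_left_mono) auto
      also have "\<dots> \<le> B"
        using that K(2) by (auto simp: mult.commute)
      finally show ?thesis
        using \<open>v x > 0\<close> by (simp add: field_simps)
    qed
    then show ?thesis by blast
  qed auto
  obtain D :: "complex set" where D: "countable D" "D \<subseteq> disk" "disk \<subseteq> closure D"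
    using separable by blast
  have "D \<noteq> {}"
    using D(3) by auto
  define q where "q = from_nat_into D"
  have q: "range q = D"
    unfolding q_def by (rule range_from_nat_into[OF \<open>D \<noteq> {}\<close> D(1)])
  have step: "\<exists>g. g holomorphic_on disk \<and> (\<forall>z\<in>insert w D. complex_of_real (v z) * g z = u z)" if w: "w \<in> disk" for w
  proof -
    have "\<exists>f. f \<in> ?G \<and> (\<forall>z\<in>insert w (q ` {..n}). cmod (?h f z - u z) < 1 / Suc n)" for n
    proof -
      have "finite (insert w (q ` {..n}))" "0 < 1 / real (Suc n)"
        by simp_all
      then obtain h
        where h: "h \<in> ?h ` ?G" "\<And>z. z \<in> insert w (q ` {..n}) \<Longrightarrow> cmod (h z - u z) < 1 / Suc n"
        using closure_fun_finite_approx[OF u] by (metis (no_types, lifting))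
      from h(1) obtain f where "f \<in> ?G" "h = ?h f"
        by (rule imageE)
      with h(2) show ?thesis
        by (intro exI[of _ f] conjI ballI) simp_all
    qed
    then have "\<exists>f. \<forall>n. f n \<in> ?G \<and> (\<forall>z\<in>insert w (q ` {..n}). cmod (?h (f n) z - u z) < 1 / Suc n)"
      by (intro choice allI)
    then obtain f where f: "\<And>n. f n \<in> ?G"
      and near: "\<And>n z. z \<in> insert w (q ` {..n}) \<Longrightarrow> cmod (?h (f n) z - u z) < 1 / Suc n"
      by blast
    have hol: "\<And>h. h \<in> ?G \<Longrightarrow> h holomorphic_on disk"
      by (simp add: Hol_def)
    have rng: "range f \<subseteq> ?G"
      using f by blast
    obtain g r where g: "g holomorphic_on disk" and r: "strict_mono (r :: nat \<Rightarrow> nat)"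
      and lim: "\<And>z. z \<in> disk \<Longrightarrow> (\<lambda>n. f (r n) z) \<longlonglongrightarrow> g z"
    proof (rule Montel[OF open_ball hol locally_bounded rng])
      fix g r
      assume "g holomorphic_on disk" "strict_mono (r :: nat \<Rightarrow> nat)"
        "\<And>z. z \<in> disk \<Longrightarrow> (\<lambda>n. f (r n) z) \<longlonglongrightarrow> g z"
      then show thesis
        by (rule that)
    qed
    have "complex_of_real (v z) * g z = u z" if z: "z \<in> insert w D" for z
    proof -
      have "z \<in> disk"
        using z w D(2) by blast
      obtain m where m: "\<And>n. n \<ge> m \<Longrightarrow> z \<in> insert w (q ` {..n})"
        using z q by fastforce
      have "(\<lambda>n. ?h (f n) z - u z) \<longlonglongrightarrow> 0"
      proof (rule Lim_null_comparison)
        show "\<forall>\<^sub>F n in sequentially. norm (?h (f n) z - u z) \<le> 1 / Suc n"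
          using eventually_ge_at_top[of m] by eventually_elim (use near m in \<open>blast intro: less_imp_le\<close>)
        show "(\<lambda>n. 1 / Suc n) \<longlonglongrightarrow> 0"
          using LIMSEQ_inverse_real_of_nat by (simp add: inverse_eq_divide)
      qed
      then have "(\<lambda>n. ?h (f (r n)) z - u z) \<longlonglongrightarrow> 0"
        using LIMSEQ_subseq_LIMSEQ[OF _ r] by (fastforce simp: o_def)
      moreover have "(\<lambda>n. ?h (f (r n)) z - u z) \<longlonglongrightarrow> complex_of_real (v z) * g z - u z"
        using \<open>z \<in> disk\<close> by simp (intro tendsto_intros lim; simp)
      ultimately show ?thesis
        using LIMSEQ_unique by fastforce
    qed
    with g show ?thesis by blast
  qed
  obtain g0 where g0: "g0 holomorphic_on disk" and g0_D: "\<And>z. z \<in> D \<Longrightarrow> complex_of_real (v z) * g0 z = u z"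
    using step[of 0] by auto
  have g0_u: "complex_of_real (v w) * g0 w = u w" if w: "w \<in> disk" for w
  proof -
    obtain g where g: "g holomorphic_on disk" and g_D: "\<And>z. z \<in> insert w D \<Longrightarrow> complex_of_real (v z) * g z = u z"
      using step[OF w] by auto
    have eq: "g z = g0 z" if "z \<in> D" for z
    proof -
      have "complex_of_real (v z) * g z = complex_of_real (v z) * g0 z"
        using g_D[of z] g0_D[of z] that by simp
      moreover have "v z > 0"
        using that D(2) typical_weight_pos[OF v] by blast
      ultimately show ?thesis
        by simp
    qed
    have cont: "isCont g w" "isCont g0 w"
      using g g0 w continuous_on_eq_continuous_at holomorphic_on_imp_continuous_on open_ball by blast+
    obtain x where x: "\<And>n. x n \<in> D" "x \<longlonglongrightarrow> w"
      using D(3) w closure_sequential by blast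
    have "(\<lambda>n. g (x n)) \<longlonglongrightarrow> g w" "(\<lambda>n. g0 (x n)) \<longlonglongrightarrow> g0 w"
      using isCont_tendsto_compose[OF _ x(2)] cont by blast+
    then have "g w = g0 w"
      using eq[OF x(1)] LIMSEQ_unique by simp
    then show ?thesis
      using g_D[of w] by simp
  qed
  define g where "g = (\<lambda>z. if z \<in> disk then g0 z else 0)"
  have "g \<in> Hol"
    using holomorphic_transform[OF g0, of g] by (simp add: Hol_def g_def)
  moreover have gu: "complex_of_real (v z) * g z = u z" if "z \<in> disk" for z
    using g0_u[OF that] that by (simp add: g_def)
  moreover have "v z * cmod (g z) \<le> B" if z: "z \<in> disk" for z
  proof -
    have "closed {h :: complex \<Rightarrow> complex. cmod (h z) \<le> B}"
      by (intro closed_Collect_le continuous_on_norm continuous_on_const continuous_on_eval)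
    moreover have "?h ` ?G \<subseteq> {h. cmod (h z) \<le> B}"
      using z typical_weight_pos[OF v z] by (auto simp: norm_mult)
    ultimately have "cmod (u z) \<le> B"
      using u closure_minimal by blast
    then show ?thesis
      using gu[OF z] typical_weight_pos[OF v z] by (metis norm_mult norm_of_real abs_of_pos)
  qed
  ultimately show ?thesis
    using that by blast
qed

section \<open>The weighted spaces as norming families\<close>

definition Hv_eval :: "(complex \<Rightarrow> real) \<Rightarrow> complex \<Rightarrow> (complex \<Rightarrow> complex) \<Rightarrow> complex" where
  "Hv_eval v z g = (if g \<in> Hv v then complex_of_real (v z) * g z else 0)"

lemma norming_family_Hv:
  assumes v: "typical_weight v"
  shows "norming_family (Hv v) (Hv_norm v) disk (Hv_eval v) 1"
proof
  note pos = typical_weight_pos[OF v]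
  have nonneg: "0 \<le> Hv_norm v f" if "f \<in> Hv v" for f
    using Hv_le[OF that, of 0] pos[of 0] by (smt (verit) centre_in_ball mult_nonneg_nonneg norm_ge_zero zero_less_one)
  have hol: "f \<in> Hol" if "f \<in> Hv v" for f
    using that by (simp add: Hv_def)
  show zero: "0 \<in> Hv v"
    by (rule Hv_I[OF Hol_zero, where a = 0]) simp
  fix f g :: "complex \<Rightarrow> complex" and c
  have add_le: "v z * cmod ((f + g) z) \<le> Hv_norm v f + Hv_norm v g" if "f \<in> Hv v" "g \<in> Hv v" "z \<in> disk" for z
  proof -
    have "v z * cmod ((f + g) z) \<le> v z * (cmod (f z) + cmod (g z))"
      using pos[OF that(3)] by (intro mult_left_mono) (auto simp: norm_triangle_ineq)
    then show ?thesis
      using Hv_le[OF that(1,3)] Hv_le[OF that(2,3)] by (simp add: algebra_simps)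
  qed
  show add: "f + g \<in> Hv v" if "f \<in> Hv v" "g \<in> Hv v"
    by (rule Hv_I[OF Hol_add[OF hol hol] add_le]) (use that in auto)
  show "Hv_norm v (f + g) \<le> Hv_norm v f + Hv_norm v g" if "f \<in> Hv v" "g \<in> Hv v"
    by (rule Hv_norm_le[OF add_le]) (use that in auto)
  have csmul_le: "v z * cmod (csmul c f z) \<le> cmod c * Hv_norm v f" if "f \<in> Hv v" "z \<in> disk" for z
    using mult_left_mono[OF Hv_le[OF that], of "cmod c"] by (simp add: norm_mult mult_ac)
  show csmul: "csmul c f \<in> Hv v" if "f \<in> Hv v"
    by (rule Hv_I[OF Hol_csmul[OF hol] csmul_le]) (use that in auto)
  show "Hv_norm v (csmul c f) = cmod c * Hv_norm v f" if f: "f \<in> Hv v"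
  proof (rule antisym)
    show "Hv_norm v (csmul c f) \<le> cmod c * Hv_norm v f"
      by (rule Hv_norm_le[OF csmul_le[OF f]])
    show "cmod c * Hv_norm v f \<le> Hv_norm v (csmul c f)"
    proof (cases "c = 0")
      case False
      have "Hv_norm v f \<le> Hv_norm v (csmul c f) / cmod c"
      proof (rule Hv_norm_le)
        fix z assume "z \<in> disk"
        then have "v z * (cmod c * cmod (f z)) \<le> Hv_norm v (csmul c f)"
          using Hv_le[OF csmul[OF f], of z] by (simp add: norm_mult)
        then show "v z * cmod (f z) \<le> Hv_norm v (csmul c f) / cmod c"
          using False by (simp add: field_simps)
      qed
      then show ?thesis
        using False by (simp add: field_simps)
    qed (use nonneg[OF csmul[OF f]] in simp)
  qed
  show "f = 0" if f: "f \<in> Hv v" and "Hv_norm v f = 0"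
  proof (rule Hol_eqI[OF hol[OF f] Hol_zero])
    fix z assume "z \<in> disk"
    then have "v z * cmod (f z) \<le> 0"
      using Hv_le[OF f, of z] that(2) by simp
    then show "f z = 0 z"
      using pos[OF \<open>z \<in> disk\<close>] by (simp add: mult_le_0_iff)
  qed
  show "disk \<noteq> {}"
    by simp
  fix z :: complex
  show "Hv_eval v z (f + g) = Hv_eval v z f + Hv_eval v z g" if "z \<in> disk" "f \<in> Hv v" "g \<in> Hv v"
    using that add by (simp add: Hv_eval_def algebra_simps)
  show "Hv_eval v z (csmul c f) = c * Hv_eval v z f" if "z \<in> disk" "f \<in> Hv v"
    using that csmul by (simp add: Hv_eval_def)
  show "Hv_eval v z f = 0" if "z \<in> disk" "f \<notin> Hv v"
    using that by (simp add: Hv_eval_def)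
  have norm_eval: "cmod (Hv_eval v z f) = v z * cmod (f z)" if "z \<in> disk" "f \<in> Hv v" for z f
    using pos[OF that(1)] that by (simp add: Hv_eval_def norm_mult)
  show "cmod (Hv_eval v z f) \<le> Hv_norm v f" if "z \<in> disk" "f \<in> Hv v"
    using Hv_le[OF that(2,1)] norm_eval[OF that] by simp
  show "Hv_norm v f \<le> 1 * a" if "f \<in> Hv v" "\<And>z. z \<in> disk \<Longrightarrow> cmod (Hv_eval v z f) \<le> a" for a
    using Hv_norm_le[of v f a] that norm_eval by simp
  show "(0::real) < 1"
    by simp
  fix u B
  assume u: "u \<in> closure ((\<lambda>f z. if z \<in> disk then Hv_eval v z f else 0) ` {f \<in> Hv v. Hv_norm v f \<le> B})"
  have "(\<lambda>f z. if z \<in> disk then Hv_eval v z f else 0) ` {f \<in> Hv v. Hv_norm v f \<le> B}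
    \<subseteq> (\<lambda>f z. if z \<in> disk then complex_of_real (v z) * f z else 0) ` {f \<in> Hol. \<forall>z\<in>disk. v z * cmod (f z) \<le> B}"
  proof clarify
    fix f assume f: "f \<in> Hv v" "Hv_norm v f \<le> B"
    have "(\<lambda>z. if z \<in> disk then Hv_eval v z f else 0) = (\<lambda>z. if z \<in> disk then complex_of_real (v z) * f z else 0)"
      using f by (auto simp: Hv_eval_def)
    moreover have "f \<in> {f \<in> Hol. \<forall>z\<in>disk. v z * cmod (f z) \<le> B}"
      using f hol Hv_le[OF f(1)] by fastforce
    ultimately show "(\<lambda>z. if z \<in> disk then Hv_eval v z f else 0) \<in>
      (\<lambda>f z. if z \<in> disk then complex_of_real (v z) * f z else 0) ` {f \<in> Hol. \<forall>z\<in>disk. v z * cmod (f z) \<le> B}"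
      by blast
  qed
  then obtain g where g: "g \<in> Hol" "\<And>z. z \<in> disk \<Longrightarrow> complex_of_real (v z) * g z = u z"
      "\<And>z. z \<in> disk \<Longrightarrow> v z * cmod (g z) \<le> B"
    using weighted_ball_pointwise_closed[OF v subsetD[OF closure_mono u]] by blast
  have "g \<in> Hv v"
    using Hv_I[OF g(1,3)] .
  then show "\<exists>f\<in>Hv v. \<forall>z\<in>disk. Hv_eval v z f = u z"
    using g by (intro bexI[of _ g]) (auto simp: Hv_eval_def)
qed

text \<open>Cut off at the disk, the derivative lies in \<open>Hol\<close> again. This lets
  \<open>Bv\<close> inherit its properties from \<open>Hv\<close>.\<close>

definition Hol_deriv :: "(complex \<Rightarrow> complex) \<Rightarrow> complex \<Rightarrow> complex" where
  "Hol_deriv f z = (if z \<in> disk then deriv f z else 0)"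

lemma Hol_deriv_Hol: "f \<in> Hol \<Longrightarrow> Hol_deriv f \<in> Hol"
  using holomorphic_transform[of "deriv f" disk "Hol_deriv f"]
  by (auto simp: Hol_def Hol_deriv_def intro: holomorphic_deriv)

lemma Hol_deriv_add:
  assumes "f \<in> Hol" "g \<in> Hol"
  shows "Hol_deriv (f + g) = Hol_deriv f + Hol_deriv g"
proof
  fix z
  show "Hol_deriv (f + g) z = (Hol_deriv f + Hol_deriv g) z"
    using assms Hol_field_differentiable[of f z] Hol_field_differentiable[of g z]
    by (simp add: Hol_deriv_def plus_fun_def)
qed

lemma Hol_deriv_csmul:
  assumes "f \<in> Hol"
  shows "Hol_deriv (csmul c f) = csmul c (Hol_deriv f)"
proof
  fix z
  show "Hol_deriv (csmul c f) z = csmul c (Hol_deriv f) z"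
    using assms Hol_field_differentiable[of f z]
    by (simp add: Hol_deriv_def csmul_def)
qed

lemma Bv_iff: "f \<in> Bv v \<longleftrightarrow> f \<in> Hol \<and> Hol_deriv f \<in> Hv v"
proof -
  have "(\<lambda>z. v z * cmod (Hol_deriv f z)) ` disk = (\<lambda>z. v z * cmod (deriv f z)) ` disk"
    by (intro image_cong) (auto simp: Hol_deriv_def)
  then show ?thesis
    using Hol_deriv_Hol by (auto simp: Bv_def Hv_def)
qed

lemma Bv_norm_eq: "Bv_norm v f = cmod (f 0) + Hv_norm v (Hol_deriv f)"
  unfolding Bv_norm_def Hv_norm_def by (simp add: Hol_deriv_def)

lemma Hol_primitive:
  assumes "g \<in> Hol"
  obtains f where "f \<in> Hol" "f 0 = c" "Hol_deriv f = g"
proof -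
  have g: "g holomorphic_on disk" "\<And>z. z \<notin> disk \<Longrightarrow> g z = 0"
    using assms by (auto simp: Hol_def)
  obtain P where P: "\<And>z. z \<in> disk \<Longrightarrow> (P has_field_derivative g z) (at z within disk)"
    using holomorphic_convex_primitive'[OF convex_ball open_ball g(1)] by blast
  define f where "f z = (if z \<in> disk then P z - P 0 + c else 0)" for z
  have deriv: "(f has_field_derivative g z) (at z)" if "z \<in> disk" for z
  proof (rule has_field_derivative_transform_within_open[where S = disk])
    show "((\<lambda>z. P z - P 0 + c) has_field_derivative g z) (at z)"
      using P[OF that] that by (auto simp: at_within_open[OF that open_ball] intro!: derivative_eq_intros)
  qed (use that in \<open>auto simp: f_def\<close>)
  have "f holomorphic_on disk"
    using deriv has_field_derivative_at_within unfolding holomorphic_on_def field_differentiable_def by blast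
  then have "f \<in> Hol"
    by (simp add: Hol_def f_def)
  moreover have "Hol_deriv f = g"
  proof
    fix z show "Hol_deriv f z = g z"
      using DERIV_imp_deriv[OF deriv[of z]] g(2)[of z] by (auto simp: Hol_deriv_def)
  qed
  ultimately show ?thesis
    using that[of f] by (simp add: f_def)
qed

lemma Hol_eq_if_Hol_deriv_zero:
  assumes "f \<in> Hol" "f 0 = 0" "Hol_deriv f = 0"
  shows "f = 0"
proof (rule Hol_eqI[OF assms(1) Hol_zero])
  fix z :: complex assume z: "z \<in> disk"
  have "(f has_field_derivative 0) (at w within disk)" if "w \<in> disk" for w
  proof -
    have "deriv f w = 0"
      using fun_cong[OF assms(3), of w] that by (simp add: Hol_deriv_def)
    then have "(f has_field_derivative 0) (at w)"
      using field_differentiable_derivI[OF Hol_field_differentiable[OF assms(1) that]] by simp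
    then show ?thesis
      by (rule has_field_derivative_at_within)
  qed
  then obtain c where "\<And>w. w \<in> disk \<Longrightarrow> f w = c"
    using has_field_derivative_zero_constant[OF convex_ball] by blast
  then show "f z = 0 z"
    using z assms(2) by (metis centre_in_ball zero_fun_apply zero_less_one)
qed

text \<open>The index \<open>None\<close> stands for the evaluation at \<open>0\<close>, which is needed to norm the Bloch-type space.\<close>
definition Bv_eval :: "(complex \<Rightarrow> real) \<Rightarrow> complex option \<Rightarrow> (complex \<Rightarrow> complex) \<Rightarrow> complex" where
  "Bv_eval v i g = (if g \<in> Bv v then case i of None \<Rightarrow> g 0 | Some z \<Rightarrow> complex_of_real (v z) * deriv g z else 0)"

text \<open>An element of \<open>Bv\<close> amounts to its value at 0 and its derivative in
  \<open>Hv\<close>. The constant is 2 because \<open>Bv_norm\<close> is the sum of these two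
  contributions, each bounded by the supremum over the family.\<close>

lemma norming_family_Bv:
  assumes v: "typical_weight v"
  shows "norming_family (Bv v) (Bv_norm v) (insert None (Some ` disk)) (Bv_eval v) 2"
proof
  interpret H: norming_family "Hv v" "Hv_norm v" disk "Hv_eval v" 1
    by (rule norming_family_Hv[OF v])
  have hol: "f \<in> Hol" and D: "Hol_deriv f \<in> Hv v" if "f \<in> Bv v" for f
    using that by (auto simp: Bv_iff)
  have D_zero: "Hol_deriv 0 = 0"
    by (simp add: Hol_deriv_def zero_fun_def fun_eq_iff)
  show zero: "0 \<in> Bv v"
    by (simp only: Bv_iff D_zero H.zero_mem Hol_zero simp_thms)
  fix f g :: "complex \<Rightarrow> complex" and c
  show add: "f + g \<in> Bv v" if "f \<in> Bv v" "g \<in> Bv v"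
    using that by (simp add: Bv_iff Hol_add Hol_deriv_add H.add_mem)
  show csmul: "csmul c f \<in> Bv v" if "f \<in> Bv v"
    using that by (simp add: Bv_iff Hol_csmul Hol_deriv_csmul H.csmul_mem)
  show "Bv_norm v (f + g) \<le> Bv_norm v f + Bv_norm v g" if "f \<in> Bv v" "g \<in> Bv v"
    using that H.norm_triangle[OF D D] norm_triangle_ineq[of "f 0" "g 0"]
    by (fastforce simp: Bv_norm_eq Hol_deriv_add hol)
  show "Bv_norm v (csmul c f) = cmod c * Bv_norm v f" if "f \<in> Bv v"
    using that by (simp add: Bv_norm_eq Hol_deriv_csmul hol H.norm_csmul D norm_mult algebra_simps)
  show "f = 0" if f: "f \<in> Bv v" and "Bv_norm v f = 0"
  proof (rule Hol_eq_if_Hol_deriv_zero[OF hol[OF f]])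
    have "cmod (f 0) = 0 \<and> Hv_norm v (Hol_deriv f) = 0"
      using that(2) H.norm_nonneg[OF D[OF f]] norm_ge_zero[of "f 0"] unfolding Bv_norm_eq by linarith
    then show "f 0 = 0" "Hol_deriv f = 0"
      using H.norm_eq_0[OF D[OF f]] by auto
  qed
  show "insert None (Some ` disk) \<noteq> {}"
    by simp
  have eval_Some: "Bv_eval v (Some z) f = Hv_eval v z (Hol_deriv f)" if "f \<in> Bv v" "z \<in> disk" for f z
    using that D by (simp add: Bv_eval_def Hv_eval_def Hol_deriv_def)
  have eval_None: "Bv_eval v None f = f 0" if "f \<in> Bv v" for f
    using that by (simp add: Bv_eval_def)
  fix i :: "complex option"
  show "Bv_eval v i (f + g) = Bv_eval v i f + Bv_eval v i g"
    if "i \<in> insert None (Some ` disk)" "f \<in> Bv v" "g \<in> Bv v"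
    using that add by (auto simp: eval_None eval_Some Hol_deriv_add hol H.s_add D)
  show "Bv_eval v i (csmul c f) = c * Bv_eval v i f" if "i \<in> insert None (Some ` disk)" "f \<in> Bv v"
    using that csmul by (auto simp: eval_None eval_Some Hol_deriv_csmul hol H.s_csmul D)
  show "Bv_eval v i f = 0" if "i \<in> insert None (Some ` disk)" "f \<notin> Bv v"
    using that by (simp add: Bv_eval_def)
  show "cmod (Bv_eval v i f) \<le> Bv_norm v f" if i: "i \<in> insert None (Some ` disk)" and f: "f \<in> Bv v"
    using i
  proof
    assume "i = None"
    then show ?thesis
      using f H.norm_nonneg[OF D[OF f]] by (simp add: eval_None Bv_norm_eq)
  next
    assume "i \<in> Some ` disk"
    then obtain z where "i = Some z" "z \<in> disk"
      by blast
    then show ?thesis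
      using f H.s_le_norm[OF _ D[OF f], of z] by (simp add: eval_Some Bv_norm_eq add_increasing)
  qed
  show "Bv_norm v f \<le> 2 * a"
    if f: "f \<in> Bv v" and a: "\<And>i. i \<in> insert None (Some ` disk) \<Longrightarrow> cmod (Bv_eval v i f) \<le> a" for a
  proof -
    have "cmod (f 0) \<le> a"
      using a[of None] f by (simp add: eval_None)
    moreover have "Hv_norm v (Hol_deriv f) \<le> 1 * a"
    proof (rule H.norm_le[OF D[OF f]])
      fix z :: complex assume "z \<in> disk"
      then show "cmod (Hv_eval v z (Hol_deriv f)) \<le> a"
        using a[of "Some z"] f by (simp add: eval_Some)
    qed
    ultimately show ?thesis
      by (simp add: Bv_norm_eq)
  qed
  show "(0::real) < 2"
    by simp
  fix u B
  let ?I = "insert None (Some ` disk)"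
  let ?h = "\<lambda>f i. if i \<in> ?I then Bv_eval v i f else 0"
  let ?k = "\<lambda>f z. if z \<in> disk then Hv_eval v z f else 0"
  let ?r = "\<lambda>(\<phi> :: complex option \<Rightarrow> complex) z. if z \<in> disk then \<phi> (Some z) else 0"
  assume u: "u \<in> closure (?h ` {f \<in> Bv v. Bv_norm v f \<le> B})"
  have "continuous_on UNIV ?r"
  proof (rule continuous_on_coordinatewise_then_product)
    fix z :: complex
    show "continuous_on UNIV (\<lambda>\<phi>. ?r \<phi> z)"
      by (cases "z \<in> disk") (simp_all add: continuous_on_eval)
  qed
  then have "?r u \<in> closure (?r ` ?h ` {f \<in> Bv v. Bv_norm v f \<le> B})"
    using u by (rule closure_image_continuous)
  moreover have "?r ` ?h ` {f \<in> Bv v. Bv_norm v f \<le> B} \<subseteq> ?k ` {f \<in> Hv v. Hv_norm v f \<le> B}"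
  proof clarify
    fix f assume f: "f \<in> Bv v" "Bv_norm v f \<le> B"
    have "?r (?h f) = ?k (Hol_deriv f)"
      using f by (auto simp: eval_Some fun_eq_iff)
    moreover have "Hv_norm v (Hol_deriv f) \<le> B"
      using f(2) norm_ge_zero[of "f 0"] unfolding Bv_norm_eq by linarith
    ultimately show "?r (?h f) \<in> ?k ` {f \<in> Hv v. Hv_norm v f \<le> B}"
      using D[OF f(1)] by blast
  qed
  ultimately have "?r u \<in> closure (?k ` {f \<in> Hv v. Hv_norm v f \<le> B})"
    using closure_mono by blast
  then obtain g where g: "g \<in> Hv v" "\<And>z. z \<in> disk \<Longrightarrow> Hv_eval v z g = ?r u z"
    using H.pointwise_closed by blast
  \<comment> \<open>The coordinates \<open>Some z\<close> have produced the derivative; the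
    coordinate \<open>None\<close> fixes the constant of integration.\<close>
  obtain f where f: "f \<in> Hol" "f 0 = u None" "Hol_deriv f = g"
    using Hol_primitive[of g "u None"] g(1) by (auto simp: Hv_def)
  then have "f \<in> Bv v"
    using g(1) by (simp add: Bv_iff)
  then show "\<exists>f\<in>Bv v. \<forall>i\<in>?I. Bv_eval v i f = u i"
    using f g(2) by (intro bexI[of _ f]) (auto simp: eval_None eval_Some)
qed

subsection \<open>The dual space\<close>

text \<open>The canonical image of \<open>f\<close> in the bidual, set to 0 outside the dual. The
  former vector \<open>f\<close> becomes the index.\<close>

definition dual_eval :: "('b \<Rightarrow> complex) set \<Rightarrow> (('b \<Rightarrow> complex) \<Rightarrow> real) \<Rightarrow> ('b \<Rightarrow> complex)
    \<Rightarrow> (('b \<Rightarrow> complex) \<Rightarrow> complex) \<Rightarrow> complex" where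
  "dual_eval V N f \<phi> = (if \<phi> \<in> dual_fs V N then \<phi> f else 0)"

lemma dnorm_fs_le:
  assumes "0 \<in> V" "N 0 \<le> 1" "\<And>f. f \<in> unit_ball_fs V N \<Longrightarrow> cmod (\<phi> f) \<le> a"
  shows "dnorm_fs V N \<phi> \<le> a"
  unfolding dnorm_fs_def by (rule cSUP_least) (use assms in \<open>auto simp: unit_ball_fs_def\<close>)

lemma le_dnorm_fs:
  assumes "\<phi> \<in> dual_fs V N" "f \<in> unit_ball_fs V N" "\<And>f. f \<in> V \<Longrightarrow> 0 \<le> N f"
  shows "cmod (\<phi> f) \<le> dnorm_fs V N \<phi>"
proof -
  obtain D where D: "D > 0" "\<And>f. f \<in> V \<Longrightarrow> cmod (\<phi> f) \<le> D * N f"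
    using dual_fs_bound[OF assms(1,3)] by blast
  have "cmod (\<phi> g) \<le> D" if "g \<in> unit_ball_fs V N" for g
  proof -
    have "g \<in> V" "D * N g \<le> D * 1"
      using that D(1) by (auto simp: unit_ball_fs_def)
    then show ?thesis
      using D(2)[of g] by simp
  qed
  then show ?thesis
    unfolding dnorm_fs_def using assms(2) by (intro cSUP_upper) (auto intro!: bdd_aboveI2)
qed

text \<open>The constant is 1 because the dual norm is by definition the supremum over the unit
  ball. The substance lies in \<open>pointwise_closed\<close>: a limit known only on the unit ball
  has to be extended to a bounded functional on all of \<open>X\<close>.\<close>

lemma norming_family_dual:
  assumes "is_banach_fs X N"
  shows "norming_family (dual_fs X N) (dnorm_fs X N) (unit_ball_fs X N) (dual_eval X N) 1"
proof
  let ?V = "dual_fs X N" and ?K = "unit_ball_fs X N"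
  have X: "0 \<in> X" "\<And>f g. \<lbrakk>f \<in> X; g \<in> X\<rbrakk> \<Longrightarrow> f + g \<in> X" "\<And>c f. f \<in> X \<Longrightarrow> csmul c f \<in> X"
    "\<And>f. f \<in> X \<Longrightarrow> 0 \<le> N f" "\<And>f. f \<in> X \<Longrightarrow> N f = 0 \<longleftrightarrow> f = 0"
    "\<And>c f. f \<in> X \<Longrightarrow> N (csmul c f) = cmod c * N f"
    using assms unfolding is_banach_fs_def by simp_all
  have N0: "N 0 = 0"
    using X(1,5) by blast
  have K_X: "f \<in> X" if "f \<in> ?K" for f
    using that by (simp add: unit_ball_fs_def)
  have dnorm_le: "dnorm_fs X N \<phi> \<le> a" if "\<And>f. f \<in> ?K \<Longrightarrow> cmod (\<phi> f) \<le> a" for \<phi> a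
    using that X(1) N0 by (intro dnorm_fs_le) auto
  have le_dnorm: "cmod (\<phi> f) \<le> dnorm_fs X N \<phi>" if "\<phi> \<in> ?V" "f \<in> ?K" for \<phi> f
    using that X(4) by (rule le_dnorm_fs)
  have zero_K: "0 \<in> ?K"
    using X(1) N0 by (simp add: unit_ball_fs_def)
  have dnorm_nonneg: "0 \<le> dnorm_fs X N \<phi>" if "\<phi> \<in> ?V" for \<phi>
    using le_dnorm[OF that zero_K] norm_ge_zero order_trans by blast
  have le_dnorm_mult: "cmod (\<phi> f) \<le> dnorm_fs X N \<phi> * N f" if \<phi>: "\<phi> \<in> ?V" and f: "f \<in> X" for \<phi> f
  proof (cases "N f = 0")
    case True
    then show ?thesis
      using dual_fs_bound[OF \<phi> X(4)] f by (metis mult_zero_right)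
  next
    case False
    then have "N f > 0"
      using X(4)[OF f] by simp
    have "csmul (of_real (1 / N f)) f \<in> ?K"
      using f X(3,6) \<open>N f > 0\<close> by (simp add: unit_ball_fs_def norm_divide)
    from le_dnorm[OF \<phi> this] show ?thesis
      using \<phi> f \<open>N f > 0\<close> by (simp add: dual_fs_def norm_mult norm_divide field_simps)
  qed
  show "0 \<in> ?V"
    by (auto simp: dual_fs_def intro: exI[of _ 0])
  fix \<phi> \<omega> :: "('a \<Rightarrow> complex) \<Rightarrow> complex" and c
  show add: "\<phi> + \<omega> \<in> ?V" if "\<phi> \<in> ?V" "\<omega> \<in> ?V"
  proof -
    have "cmod ((\<phi> + \<omega>) f) \<le> (dnorm_fs X N \<phi> + dnorm_fs X N \<omega>) * N f" if "f \<in> X" for f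
      using le_dnorm_mult[OF \<open>\<phi> \<in> ?V\<close> that] le_dnorm_mult[OF \<open>\<omega> \<in> ?V\<close> that] norm_triangle_ineq[of "\<phi> f" "\<omega> f"]
      by (simp add: distrib_right)
    then have "\<exists>C. \<forall>f\<in>X. cmod ((\<phi> + \<omega>) f) \<le> C * N f"
      by blast
    then show ?thesis
      using that by (simp add: dual_fs_def algebra_simps)
  qed
  show csmul: "csmul c \<phi> \<in> ?V" if "\<phi> \<in> ?V"
  proof -
    have "cmod (csmul c \<phi> f) \<le> (cmod c * dnorm_fs X N \<phi>) * N f" if "f \<in> X" for f
      using mult_left_mono[OF le_dnorm_mult[OF \<open>\<phi> \<in> ?V\<close> that], of "cmod c"] by (simp add: norm_mult mult.assoc)
    then have "\<exists>C. \<forall>f\<in>X. cmod (csmul c \<phi> f) \<le> C * N f"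
      by blast
    then show ?thesis
      using that by (simp add: dual_fs_def algebra_simps)
  qed
  show "dnorm_fs X N (\<phi> + \<omega>) \<le> dnorm_fs X N \<phi> + dnorm_fs X N \<omega>" if "\<phi> \<in> ?V" "\<omega> \<in> ?V"
  proof (rule dnorm_le)
    fix f assume "f \<in> ?K"
    then show "cmod ((\<phi> + \<omega>) f) \<le> dnorm_fs X N \<phi> + dnorm_fs X N \<omega>"
      using le_dnorm[OF that(1)] le_dnorm[OF that(2)] norm_triangle_ineq[of "\<phi> f" "\<omega> f"] by fastforce
  qed
  show "dnorm_fs X N (csmul c \<phi>) = cmod c * dnorm_fs X N \<phi>" if \<phi>: "\<phi> \<in> ?V"
  proof (rule antisym)
    show "dnorm_fs X N (csmul c \<phi>) \<le> cmod c * dnorm_fs X N \<phi>"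
      using le_dnorm[OF \<phi>] by (intro dnorm_le) (auto simp: norm_mult mult_left_mono)
    show "cmod c * dnorm_fs X N \<phi> \<le> dnorm_fs X N (csmul c \<phi>)"
    proof (cases "c = 0")
      case False
      have "dnorm_fs X N \<phi> \<le> dnorm_fs X N (csmul c \<phi>) / cmod c"
        using le_dnorm[OF csmul[OF \<phi>]] False by (intro dnorm_le) (simp add: norm_mult field_simps)
      then show ?thesis
        using False by (simp add: field_simps)
    qed (use dnorm_nonneg[OF csmul[OF \<phi>]] in simp)
  qed
  show "\<phi> = 0" if \<phi>: "\<phi> \<in> ?V" "dnorm_fs X N \<phi> = 0"
  proof
    fix f
    show "\<phi> f = 0 f"
      using le_dnorm_mult[OF \<phi>(1), of f] \<phi> by (cases "f \<in> X") (auto simp: dual_fs_def)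
  qed
  show "?K \<noteq> {}"
    using zero_K by blast
  fix f :: "'a \<Rightarrow> complex"
  show "dual_eval X N f (\<phi> + \<omega>) = dual_eval X N f \<phi> + dual_eval X N f \<omega>" if "f \<in> ?K" "\<phi> \<in> ?V" "\<omega> \<in> ?V"
    using that add by (simp add: dual_eval_def)
  show "dual_eval X N f (csmul c \<phi>) = c * dual_eval X N f \<phi>" if "f \<in> ?K" "\<phi> \<in> ?V"
    using that csmul by (simp add: dual_eval_def)
  show "dual_eval X N f \<phi> = 0" if "f \<in> ?K" "\<phi> \<notin> ?V"
    using that by (simp add: dual_eval_def)
  show "cmod (dual_eval X N f \<phi>) \<le> dnorm_fs X N \<phi>" if "f \<in> ?K" "\<phi> \<in> ?V"
    using that le_dnorm by (simp add: dual_eval_def)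
  show "dnorm_fs X N \<phi> \<le> 1 * a" if "\<phi> \<in> ?V" "\<And>f. f \<in> ?K \<Longrightarrow> cmod (dual_eval X N f \<phi>) \<le> a" for a
    using that dnorm_le[of \<phi> a] by (simp add: dual_eval_def)
  show "(0::real) < 1"
    by simp
  fix u B
  let ?h = "\<lambda>\<phi> f. if f \<in> ?K then dual_eval X N f \<phi> else 0"
  let ?r = "\<lambda>\<phi> f. if f \<in> ?K then \<phi> f else (0::complex)"
  assume u: "u \<in> closure (?h ` {\<phi> \<in> ?V. dnorm_fs X N \<phi> \<le> B})"
  \<comment> \<open>Linear maps with bound \<open>B\<close> form a compact set. Their restrictions
    to the unit ball are then closed and contain the given family, so the limit \<open>u\<close> is
    itself such a restriction.\<close>
  define box where "box = {\<phi>. \<forall>f. \<phi> f \<in> cball (0::complex) (if f \<in> X then B * N f else 0)}"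
  define lin where "lin = (\<Inter>f\<in>X. \<Inter>g\<in>X. {\<phi> :: ('a \<Rightarrow> complex) \<Rightarrow> complex. \<phi> (f + g) = \<phi> f + \<phi> g})
    \<inter> (\<Inter>c. \<Inter>f\<in>X. {\<phi> :: ('a \<Rightarrow> complex) \<Rightarrow> complex. \<phi> (csmul c f) = c * \<phi> f})"
  have "compact box"
    unfolding box_def by (rule compact_box_fun) simp
  moreover have "closed lin"
    unfolding lin_def
    by (intro closed_Int closed_INT ballI closed_Collect_eq continuous_on_add continuous_on_mult continuous_on_const continuous_on_eval)
  ultimately have "compact (box \<inter> lin)"
    by (rule compact_Int_closed)
  moreover have "continuous_on (box \<inter> lin) ?r"
  proof (rule continuous_on_coordinatewise_then_product)
    fix f
    show "continuous_on (box \<inter> lin) (\<lambda>\<phi>. ?r \<phi> f)"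
      by (cases "f \<in> ?K") (simp_all add: continuous_on_eval)
  qed
  ultimately have "closed (?r ` (box \<inter> lin))"
    by (intro compact_imp_closed_fun compact_continuous_image)
  moreover have "?h ` {\<phi> \<in> ?V. dnorm_fs X N \<phi> \<le> B} \<subseteq> ?r ` (box \<inter> lin)"
  proof clarify
    fix \<phi> assume \<phi>: "\<phi> \<in> ?V" "dnorm_fs X N \<phi> \<le> B"
    have "cmod (\<phi> f) \<le> B * N f" if "f \<in> X" for f
      using le_dnorm_mult[OF \<phi>(1) that] mult_right_mono[OF \<phi>(2) X(4)[OF that]] by linarith
    then have "\<phi> \<in> box \<inter> lin"
      using \<phi>(1) by (auto simp: box_def lin_def dual_fs_def)
    moreover have "?h \<phi> = ?r \<phi>"
      using \<phi>(1) by (auto simp: dual_eval_def)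
    ultimately show "?h \<phi> \<in> ?r ` (box \<inter> lin)"
      by blast
  qed
  ultimately have "u \<in> ?r ` (box \<inter> lin)"
    using u closure_minimal by blast
  then obtain \<phi> where \<phi>: "\<phi> \<in> box \<inter> lin" "u = ?r \<phi>"
    by blast
  have box: "cmod (\<phi> f) \<le> (if f \<in> X then B * N f else 0)" for f
    using \<phi>(1) by (simp add: box_def)
  have "\<phi> \<in> ?V"
    unfolding dual_fs_def
  proof (intro CollectI conjI)
    show "\<exists>C. \<forall>f\<in>X. cmod (\<phi> f) \<le> C * N f"
      using box by (intro exI[of _ B] ballI) (metis (full_types))
    show "\<forall>f. f \<notin> X \<longrightarrow> \<phi> f = 0"
      using box by (metis norm_le_zero_iff)
  qed (use \<phi>(1) in \<open>auto simp: lin_def\<close>)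
  then show "\<exists>\<phi>\<in>?V. \<forall>f\<in>?K. dual_eval X N f \<phi> = u f"
    using \<phi>(2) by (intro bexI[of _ \<phi>]) (auto simp: dual_eval_def)
qed

subsection \<open>Compact operators and their adjoints\<close>

context norming_family
begin

text \<open>The number \<open>s i (T f)\<close> is the coordinate of \<open>T f\<close> at
  \<open>i\<close> and the coordinate of the adjoint image of \<open>s i\<close> at
  \<open>f\<close>, so the two sets form a \<open>norming_pair\<close>.\<close>

lemma compact_op_adjoint_iff:
  fixes T :: "('b \<Rightarrow> complex) \<Rightarrow> ('a \<Rightarrow> complex)"
  assumes X: "is_banach_fs X NX" and T: "bounded_op X NX V N T"
    and T_add: "\<And>f g. \<lbrakk>f \<in> X; g \<in> X\<rbrakk> \<Longrightarrow> T (f + g) = T f + T g"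
    and T_csmul: "\<And>c f. f \<in> X \<Longrightarrow> T (csmul c f) = csmul c (T f)"
    and J: "countable J" "J \<subseteq> I" and dense: "\<And>i. i \<in> I \<Longrightarrow> s i \<in> closure (s ` J)"
  shows "compact_op X NX V N T \<longleftrightarrow>
      rel_compact_in (norm_top_fs (dual_fs X NX) (dnorm_fs X NX)) ((\<lambda>i. adjoint_op X T (s i)) ` I)"
    and "weakly_compact_op X NX V N T \<longleftrightarrow>
      rel_compact_in (weak_top_fs (dual_fs X NX) (dnorm_fs X NX)) ((\<lambda>i. adjoint_op X T (s i)) ` I)"
    and "i \<in> I \<Longrightarrow> adjoint_op X T (s i) \<in> dual_fs X NX"
proof -
  interpret D: norming_family "dual_fs X NX" "dnorm_fs X NX" "unit_ball_fs X NX" "dual_eval X NX" 1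
    by (rule norming_family_dual[OF X])
  have zero: "0 \<in> X" and add: "\<And>f g. \<lbrakk>f \<in> X; g \<in> X\<rbrakk> \<Longrightarrow> f + g \<in> X"
    and csmul: "\<And>c f. f \<in> X \<Longrightarrow> csmul c f \<in> X" and nonneg: "\<And>f. f \<in> X \<Longrightarrow> 0 \<le> NX f" and N0: "NX 0 = 0"
    using X unfolding is_banach_fs_def by simp_all
  obtain C' where T_V: "\<And>f. f \<in> X \<Longrightarrow> T f \<in> V" and C': "\<And>f. f \<in> X \<Longrightarrow> N (T f) \<le> C' * NX f"
    using T unfolding bounded_op_def by blast
  \<comment> \<open>\<open>bounded_op\<close> does not fix the sign of its constant, hence the
    absolute value.\<close>
  have T_bound: "N (T f) \<le> \<bar>C'\<bar>" if "f \<in> unit_ball_fs X NX" for f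
  proof -
    have "f \<in> X" "NX f \<le> 1"
      using that by (auto simp: unit_ball_fs_def)
    then have "C' * NX f \<le> \<bar>C'\<bar> * 1"
      using nonneg by (intro mult_mono) auto
    then show ?thesis
      using C'[OF \<open>f \<in> X\<close>] by simp
  qed
  show dual: "adjoint_op X T (s i) \<in> dual_fs X NX" if i: "i \<in> I" for i
    unfolding dual_fs_def
  proof (intro CollectI conjI)
    show "\<exists>C. \<forall>f\<in>X. cmod (adjoint_op X T (s i) f) \<le> C * NX f"
      using order_trans[OF s_le_norm[OF i T_V] C'] by (intro exI[of _ C']) (simp add: adjoint_op_def)
  qed (use i in \<open>auto simp: adjoint_op_def add csmul T_add T_csmul s_add s_csmul T_V\<close>)
  interpret P: norming_pair V N I s C "dual_fs X NX" "dnorm_fs X NX" "unit_ball_fs X NX" "dual_eval X NX" 1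
    T "\<lambda>i. adjoint_op X T (s i)" "\<bar>C'\<bar>"
  proof
    fix f assume f: "f \<in> unit_ball_fs X NX"
    then have "f \<in> X"
      by (simp add: unit_ball_fs_def)
    then show "T f \<in> V"
      by (rule T_V)
    show "N (T f) \<le> \<bar>C'\<bar>"
      by (rule T_bound[OF f])
    show "s i (T f) = dual_eval X NX f (adjoint_op X T (s i))" if "i \<in> I" for i
      using that dual \<open>f \<in> X\<close> by (simp add: dual_eval_def adjoint_op_def)
  next
    fix i assume i: "i \<in> I"
    then show "adjoint_op X T (s i) \<in> dual_fs X NX"
      by (rule dual)
    show "dnorm_fs X NX (adjoint_op X T (s i)) \<le> \<bar>C'\<bar>"
    proof (rule dnorm_fs_le[of X NX, OF zero])
      fix f assume f: "f \<in> unit_ball_fs X NX"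
      then show "cmod (adjoint_op X T (s i) f) \<le> \<bar>C'\<bar>"
        using order_trans[OF s_le_norm[OF i T_V] T_bound[OF f]] by (simp add: adjoint_op_def unit_ball_fs_def)
    qed (simp add: N0)
  qed
  show "compact_op X NX V N T \<longleftrightarrow>
      rel_compact_in (norm_top_fs (dual_fs X NX) (dnorm_fs X NX)) ((\<lambda>i. adjoint_op X T (s i)) ` I)"
    unfolding compact_op_def by (rule P.rel_compact_iff)
  show "weakly_compact_op X NX V N T \<longleftrightarrow>
      rel_compact_in (weak_top_fs (dual_fs X NX) (dnorm_fs X NX)) ((\<lambda>i. adjoint_op X T (s i)) ` I)"
    unfolding weakly_compact_op_def by (rule P.rel_weakly_compact_iff[OF J dense])
qed

end

section \<open>Density of countably many evaluations, and the theorem\<close>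

lemma in_closure_if_tendsto:
  assumes "\<And>n::nat. x n \<in> S" and "x \<longlonglongrightarrow> l"
  shows "l \<in> closure S"
  using Lim_in_closed_set[OF closed_closure _ _ assms(2)] assms(1) closure_subset
  by (metis always_eventually subsetD trivial_limit_sequentially)

lemma weighted_Hol_tendsto:
  assumes "typical_weight v" "g \<in> Hol" "z \<in> disk" "\<And>n. x n \<in> disk" "x \<longlonglongrightarrow> z"
  shows "(\<lambda>n. complex_of_real (v (x n)) * g (x n)) \<longlonglongrightarrow> complex_of_real (v z) * g z"
proof -
  have "continuous_on disk v" "continuous_on disk g"
    using assms(1,2) by (auto simp: typical_weight_def Hol_def holomorphic_on_imp_continuous_on)
  then have "continuous_on disk (\<lambda>z. complex_of_real (v z) * g z)"
    by (intro continuous_intros)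
  then show ?thesis
    using continuous_on_tendsto_compose[OF _ assms(5,3)] assms(4) by auto
qed

lemma Hv_eval_dense:
  assumes "typical_weight v" "D \<subseteq> disk" "z \<in> disk" "z \<in> closure D"
  shows "Hv_eval v z \<in> closure (Hv_eval v ` D)"
proof -
  obtain x where x: "\<And>n. x n \<in> D" "x \<longlonglongrightarrow> z"
    using assms(4) closure_sequential by blast
  have "(\<lambda>n. Hv_eval v (x n)) \<longlonglongrightarrow> Hv_eval v z"
    unfolding tendsto_fun_iff
  proof
    fix g
    have x_disk: "x n \<in> disk" for n
      using x(1) assms(2) by blast
    show "(\<lambda>n. Hv_eval v (x n) g) \<longlonglongrightarrow> Hv_eval v z g"
      using weighted_Hol_tendsto[OF assms(1) _ assms(3) x_disk x(2), of g]
      by (cases "g \<in> Hv v") (auto simp: Hv_eval_def Hv_def)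
  qed
  then show ?thesis
    using x(1) by (intro in_closure_if_tendsto[of "\<lambda>n. Hv_eval v (x n)"]) auto
qed

lemma Bv_eval_dense:
  assumes "typical_weight v" "D \<subseteq> disk" "z \<in> disk" "z \<in> closure D"
  shows "Bv_eval v (Some z) \<in> closure (Bv_eval v ` Some ` D)"
proof -
  obtain x where x: "\<And>n. x n \<in> D" "x \<longlonglongrightarrow> z"
    using assms(4) closure_sequential by blast
  have "(\<lambda>n. Bv_eval v (Some (x n))) \<longlonglongrightarrow> Bv_eval v (Some z)"
    unfolding tendsto_fun_iff
  proof
    fix g
    have x_disk: "x n \<in> disk" for n
      using x(1) assms(2) by blast
    show "(\<lambda>n. Bv_eval v (Some (x n)) g) \<longlonglongrightarrow> Bv_eval v (Some z) g"
    proof (cases "g \<in> Bv v")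
      case True
      then have "Hol_deriv g \<in> Hol"
        by (auto simp: Bv_iff Hol_deriv_Hol)
      from weighted_Hol_tendsto[OF assms(1) this assms(3) x_disk x(2)] show ?thesis
        using True x_disk assms(3) by (simp add: Bv_eval_def Hol_deriv_def)
    qed (simp add: Bv_eval_def)
  qed
  then show ?thesis
    using x(1) by (intro in_closure_if_tendsto[of "\<lambda>n. Bv_eval v (Some (x n))"]) auto
qed

theorem theorem3p1:
  fixes v :: "complex \<Rightarrow> real"
    and T :: "(complex \<Rightarrow> complex) \<Rightarrow> (complex \<Rightarrow> complex)"
    and X :: "(complex \<Rightarrow> complex) set"
    and NX :: "(complex \<Rightarrow> complex) \<Rightarrow> real"
  assumes "typical_weight v" and "intrinsic T" and "initial_space X NX"
  shows "(bounded_op X NX (Hv v) (Hv_norm v) T \<longrightarrow>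
            (compact_op X NX (Hv v) (Hv_norm v) T \<longleftrightarrow>
               rel_compact_in (norm_top_fs (dual_fs X NX) (dnorm_fs X NX))
                 ((\<lambda>z. csmul (complex_of_real (v z)) (adjoint_op X T (KH v z))) ` disk)) \<and>
            (weakly_compact_op X NX (Hv v) (Hv_norm v) T \<longleftrightarrow>
               rel_compact_in (weak_top_fs (dual_fs X NX) (dnorm_fs X NX))
                 ((\<lambda>z. csmul (complex_of_real (v z)) (adjoint_op X T (KH v z))) ` disk)))
       \<and> (bounded_op X NX (Bv v) (Bv_norm v) T \<longrightarrow>
            (compact_op X NX (Bv v) (Bv_norm v) T \<longleftrightarrow>
               rel_compact_in (norm_top_fs (dual_fs X NX) (dnorm_fs X NX))
                 ((\<lambda>z. csmul (complex_of_real (v z)) (adjoint_op X T (KB1 v z))) ` disk)) \<and>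
            (weakly_compact_op X NX (Bv v) (Bv_norm v) T \<longleftrightarrow>
               rel_compact_in (weak_top_fs (dual_fs X NX) (dnorm_fs X NX))
                 ((\<lambda>z. csmul (complex_of_real (v z)) (adjoint_op X T (KB1 v z))) ` disk)))"
proof (intro conjI[of "bounded_op X NX (Hv v) (Hv_norm v) T \<longrightarrow> _"] impI)
  have X: "is_banach_fs X NX" and "X \<subseteq> Hol"
    using assms(3) by (auto simp: initial_space_def)
  then have T_add: "\<And>f g. \<lbrakk>f \<in> X; g \<in> X\<rbrakk> \<Longrightarrow> T (f + g) = T f + T g"
    and T_csmul: "\<And>c f. f \<in> X \<Longrightarrow> T (csmul c f) = csmul c (T f)"
    using assms(2) unfolding intrinsic_def linear_on_Hol_def by blast+
  obtain D :: "complex set" where D: "countable D" "D \<subseteq> disk" "disk \<subseteq> closure D"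
    using separable by blast
  {
    assume T: "bounded_op X NX (Hv v) (Hv_norm v) T"
    have dense: "Hv_eval v z \<in> closure (Hv_eval v ` D)" if "z \<in> disk" for z
      using Hv_eval_dense[OF assms(1) D(2) that] that D(3) by blast
    have "csmul (complex_of_real (v z)) (adjoint_op X T (KH v z)) = adjoint_op X T (Hv_eval v z)" for z
      by (simp add: fun_eq_iff adjoint_op_def KH_def Hv_eval_def)
    then show "(compact_op X NX (Hv v) (Hv_norm v) T \<longleftrightarrow>
               rel_compact_in (norm_top_fs (dual_fs X NX) (dnorm_fs X NX))
                 ((\<lambda>z. csmul (complex_of_real (v z)) (adjoint_op X T (KH v z))) ` disk)) \<and>
            (weakly_compact_op X NX (Hv v) (Hv_norm v) T \<longleftrightarrow>
               rel_compact_in (weak_top_fs (dual_fs X NX) (dnorm_fs X NX))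
                 ((\<lambda>z. csmul (complex_of_real (v z)) (adjoint_op X T (KH v z))) ` disk))"
      using norming_family.compact_op_adjoint_iff(1,2)[OF norming_family_Hv[OF assms(1)] X T T_add T_csmul D(1,2) dense]
      by simp
  }
  {
    assume T: "bounded_op X NX (Bv v) (Bv_norm v) T"
    let ?I = "insert None (Some ` disk)" and ?J = "insert None (Some ` D)"
    let ?A = "(\<lambda>z. csmul (complex_of_real (v z)) (adjoint_op X T (KB1 v z))) ` disk"
    have J: "countable ?J" "?J \<subseteq> ?I"
      using D by auto
    have dense: "Bv_eval v i \<in> closure (Bv_eval v ` ?J)" if "i \<in> ?I" for i
      using that
    proof
      \<comment> \<open>Evaluation at 0 is not obtained as a limit of derivative evaluations here,
        so it is put into \<open>?J\<close> itself.\<close>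
      assume "i = None"
      then show ?thesis
        using closure_subset[of "Bv_eval v ` ?J"] by auto
    next
      assume "i \<in> Some ` disk"
      then obtain z where z: "i = Some z" "z \<in> disk"
        by blast
      then have "Bv_eval v i \<in> closure (Bv_eval v ` Some ` D)"
        using Bv_eval_dense[OF assms(1) D(2)] D(3) by blast
      moreover have "Bv_eval v ` Some ` D \<subseteq> Bv_eval v ` ?J"
        by blast
      ultimately show ?thesis
        using closure_mono by blast
    qed
    note iff = norming_family.compact_op_adjoint_iff[OF norming_family_Bv[OF assms(1)] X T T_add T_csmul J dense]
    interpret X': norming_family "dual_fs X NX" "dnorm_fs X NX" "unit_ball_fs X NX" "dual_eval X NX" 1
      by (rule norming_family_dual[OF X])
    have "csmul (complex_of_real (v z)) (adjoint_op X T (KB1 v z)) = adjoint_op X T (Bv_eval v (Some z))" for z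
      by (simp add: fun_eq_iff adjoint_op_def KB1_def Bv_eval_def)
    then have A: "(\<lambda>i. adjoint_op X T (Bv_eval v i)) ` ?I = insert (adjoint_op X T (Bv_eval v None)) ?A"
      by (simp add: image_image)
    moreover have "(\<lambda>i. adjoint_op X T (Bv_eval v i)) ` ?I \<subseteq> dual_fs X NX"
      using iff(3) by blast
    ultimately have mem: "adjoint_op X T (Bv_eval v None) \<in> dual_fs X NX" "?A \<subseteq> dual_fs X NX"
      by auto
    show "(compact_op X NX (Bv v) (Bv_norm v) T \<longleftrightarrow>
               rel_compact_in (norm_top_fs (dual_fs X NX) (dnorm_fs X NX)) ?A) \<and>
            (weakly_compact_op X NX (Bv v) (Bv_norm v) T \<longleftrightarrow>
               rel_compact_in (weak_top_fs (dual_fs X NX) (dnorm_fs X NX)) ?A)"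
      \<comment> \<open>The equivalences hold for the set enlarged by the adjoint image of
        evaluation at 0; in the Hausdorff norm and weak topologies of the dual this point can be
        removed.\<close>
      using iff(1,2) rel_compact_in_insert_iff[OF X'.Hausdorff_norm_top_fs]
        rel_compact_in_insert_iff[OF X'.Hausdorff_weak_top] mem
      unfolding A by (simp add: X'.topspace_norm_top_fs)
  }
qed

end
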